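(* Let $\mu\in\mathbb{C}$ with $|\operatorname{Re}\mu|<1/2$, let $\{a_m\}_{m\in\mathbb{N}}$ be a complex sequence with $\sum_{m=1}^\infty|a_m|<\infty$, and let $f(x)=\sum_{m=1}^\infty a_m P^\mu_{im-1/2}(x)$ for $x>1$. Then for all $x>1$, $$f(x)=\frac1\pi\sum_{n=1}^\infty n\sinh(\pi n)\,\Gamma\!\left(\tfrac12+in-\mu\right)\Gamma\!\left(\tfrac12-in-\mu\right)P^\mu_{in-1/2}(x)\int_1^\infty P^\mu_{in-1/2}(t,\pi)f(t)\,dt,$$ and the iterated series and integral converge absolutely.
   Context: $\Gamma$ is Euler's gamma function and $i$ the imaginary unit; powers of positive numbers are principal values. For $x>1$, $P^\mu_\nu(x)$ is the associated Legendre function (of the first kind), i.e. the analytic continuation to $x>1$ of $P^\mu_\nu(z)=\frac{1}{\Gamma(1-\mu)}\left(\frac{z+1}{z-1}\right)^{\mu/2}{}_2F_1\!\left(-\nu,1+\nu;1-\mu;\frac{1-z}{2}\right)$ ($|1-z|<2$), ${}_2F_1$ the Gauss hypergeometric function. The incomplete Legendre integral is defined for $z>1$, $\omega>0$ by $$P^\mu_\nu(z,\omega)=\sqrt{\tfrac{2}{\pi}}\,\frac{\Gamma(1/2-\mu)(z^2-1)^{-\mu/2}}{\Gamma(1+\nu-\mu)\Gamma(-\nu-\mu)}\int_0^\omega\frac{\cosh(t(\nu+1/2))}{(\cosh t+z)^{1/2-\mu}}\,dt;$$ here $\nu=in-1/2$, $\omega=\pi$. *)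

theory Defs
  imports "HOL-Analysis.Analysis"
begin

definition hyp2F1 :: "complex \<Rightarrow> complex \<Rightarrow> complex \<Rightarrow> complex \<Rightarrow> complex" where
  "hyp2F1 a b c w =
     (\<Sum>k. pochhammer a k * pochhammer b k / (pochhammer c k * fact k) * w ^ k)"

text \<open>The defining formula of the associated Legendre function near z = 1,
  valid for norm (1 - z) < 2 (principal powers).\<close>
definition LegP_near :: "complex \<Rightarrow> complex \<Rightarrow> complex \<Rightarrow> complex" where
  "LegP_near \<mu> \<nu> z =
     1 / Gamma (1 - \<mu>) * ((z + 1) / (z - 1)) powr (\<mu> / 2)
       * hyp2F1 (- \<nu>) (1 + \<nu>) (1 - \<mu>) ((1 - z) / 2)"

text \<open>Associated Legendre function of the first kind at real x > 1: the value at x of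
  the analytic continuation of LegP_near, i.e. of any holomorphic function on a
  connected open set containing the ray (1,\<infinity>) that agrees with LegP_near on
  its intersection with the disc norm (z - 1) < 2.  (Independent of the choice by the
  identity theorem.)\<close>
definition LegP :: "complex \<Rightarrow> complex \<Rightarrow> real \<Rightarrow> complex" where
  "LegP \<mu> \<nu> x =
     (SOME v. \<exists>S G. open S \<and> connected S \<and> complex_of_real ` {1<..} \<subseteq> S \<and>
        G holomorphic_on S \<and> (\<forall>z\<in>S \<inter> ball 1 2. G z = LegP_near \<mu> \<nu> z) \<and>
        v = G (complex_of_real x))"

definition LegP_inc :: "complex \<Rightarrow> complex \<Rightarrow> real \<Rightarrow> real \<Rightarrow> complex" where
  "LegP_inc \<mu> \<nu> z \<omega> =
     complex_of_real (sqrt (2 / pi)) * Gamma (1/2 - \<mu>)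
       * (complex_of_real (z\<^sup>2 - 1)) powr (- \<mu> / 2)
       / (Gamma (1 + \<nu> - \<mu>) * Gamma (- \<nu> - \<mu>))
       * integral {0..\<omega>} (\<lambda>t. cosh (complex_of_real t * (\<nu> + 1/2))
            / (complex_of_real (cosh t + z)) powr (1/2 - \<mu>))"

end

theory Submission
  imports Defs "HOL-Complex_Analysis.Complex_Analysis"
begin

text \<open>
  The Mehler-Dirichlet formula writes the Legendre function with index \<open>i m - 1/2\<close> at \<open>t\<close> as a constant
  times \<open>(t^2 - 1)^(mu/2)\<close> times the integral of \<open>cos (m u) (t - cosh u)^(-mu-1/2)\<close> over \<open>cosh u < t\<close>.
  It bounds these functions uniformly in \<open>m\<close>, which gives absolute convergence of the series and allows
  termwise integration.

  An integration by parts turns the incomplete Legendre integral at \<open>omega = pi\<close> into the integral of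
  \<open>sin (n s) sinh s (t + cosh s)^(mu-3/2)\<close> over \<open>[0, pi]\<close>. Integrating the product of the two
  integrands over \<open>t > cosh u\<close> is elementary and leaves a multiple of \<open>1 / (cosh s + cosh u)\<close>, whose cosine
  transform in \<open>u\<close> is \<open>pi sin (m s) / (sinh s sinh (pi m))\<close>. The orthogonality of the functions
  \<open>sin (m s)\<close> on \<open>[0, pi]\<close> then picks the coefficient \<open>a n\<close> out of \<open>f\<close>.
\<close>

subsection \<open>Complex powers of positive reals and the Beta integral\<close>

text \<open>\<open>LegP\<close> is picked by \<open>SOME\<close> among all continuations, and the
  hypergeometric series gives no value for \<open>x \<ge> 3\<close>; only an explicit holomorphic
  function on a set around the whole ray identifies it. In \<open>w = (z - 1) / 2\<close> the series
  is an Euler transform of the one with lower parameter 1/2, and that one is the elementary function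
  \<open>cos (m u) / cosh (u / 2)\<close>. So it is enough to continue an elementary function under
  an integral sign.

  The integration by parts is forced by decay. The Legendre kernel carries the exponent
  \<open>-\<mu> - 1/2\<close> and the incomplete integral the exponent \<open>\<mu> - 1/2\<close>,
  so their product decays only like \<open>1/t\<close>, and the integrals cannot be exchanged
  absolutely. One step lowers the total exponent to \<open>-2\<close>; with
  \<open>b = 1/2 - \<mu>\<close> the product is then the derivative of a multiple of
  \<open>((t - p) / (t + q))^b\<close>. The upper limit pi and the integer \<open>n\<close> remove
  the boundary terms, and the new factor \<open>sinh s\<close> cancels the \<open>1 / sinh s\<close>
  of the cosine transform, so that pure sines remain.\<close>

text \<open>Using the real logarithm makes the power Borel measurable on the whole line by construction; its values
  at nonpositive reals are irrelevant.\<close>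

definition rpow :: "real \<Rightarrow> complex \<Rightarrow> complex" where
  "rpow x a = exp (a * of_real (ln x))"

lemma rpow_measurable [measurable]: "(\<lambda>x. rpow x a) \<in> borel_measurable borel"
  unfolding rpow_def by measurable

lemma rpow_eq_powr: "x > 0 \<Longrightarrow> rpow x a = of_real x powr a"
  by (simp add: rpow_def powr_def Ln_of_real)

lemma norm_rpow: "x > 0 \<Longrightarrow> norm (rpow x a) = x powr Re a"
  by (simp add: rpow_def powr_def)

lemma rpow_of_real: "x > 0 \<Longrightarrow> rpow x (of_real a) = of_real (x powr a)"
  by (simp add: rpow_eq_powr powr_of_real)

lemma rpow_nonzero [simp]: "rpow x a \<noteq> 0"
  by (simp add: rpow_def)

lemma rpow_mult: "x > 0 \<Longrightarrow> y > 0 \<Longrightarrow> rpow (x * y) a = rpow x a * rpow y a"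
  by (simp add: rpow_def ln_mult algebra_simps exp_add)

lemma rpow_divide: "x > 0 \<Longrightarrow> y > 0 \<Longrightarrow> rpow (x / y) a = rpow x a / rpow y a"
  by (simp add: rpow_def ln_div algebra_simps exp_diff)

lemma rpow_add: "rpow x (a + b) = rpow x a * rpow x b"
  by (simp add: rpow_def algebra_simps exp_add)

lemma rpow_diff: "rpow x (a - b) = rpow x a / rpow x b"
  by (simp add: rpow_def algebra_simps exp_diff)

lemma rpow_minus: "rpow x (- a) = inverse (rpow x a)"
  by (simp add: rpow_def exp_minus)

lemma rpow_one: "x > 0 \<Longrightarrow> rpow x 1 = of_real x"
  by (simp add: rpow_eq_powr)

lemma has_vector_derivative_rpow:
  assumes "x > 0" and "(f has_real_derivative d) (at x')" and "f x' = x"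
  shows "((\<lambda>x. rpow (f x) a) has_vector_derivative (a * rpow x (a - 1) * of_real d)) (at x')"
proof -
  have "((\<lambda>x. ln (f x)) has_real_derivative (d / x)) (at x')"
    using assms by (auto intro!: derivative_eq_intros)
  hence "((\<lambda>y. a * of_real (ln (f y))) has_vector_derivative a * of_real (d / x)) (at x')"
    by (intro has_vector_derivative_mult_right has_vector_derivative_of_real)
       (simp add: has_real_derivative_iff_has_vector_derivative)
  hence "((exp \<circ> (\<lambda>y. a * of_real (ln (f y)))) has_vector_derivative
           (a * of_real (d / x)) * exp (a * of_real (ln (f x')))) (at x')"
    by (rule field_vector_diff_chain_at) (rule DERIV_exp)
  moreover have "(a * of_real (d / x)) * exp (a * of_real (ln (f x'))) =
      a * rpow x (a - 1) * of_real d"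
    using assms(1,3) unfolding rpow_diff by (simp add: rpow_one) (simp add: rpow_def)
  ultimately show ?thesis by (simp add: o_def rpow_def)
qed

lemma continuous_on_rpow [continuous_intros]:
  assumes "continuous_on S f" "\<And>x. x \<in> S \<Longrightarrow> f x > 0"
  shows "continuous_on S (\<lambda>x. rpow (f x) a)"
  unfolding rpow_def using assms
  by (intro continuous_intros) (auto simp: less_imp_neq[THEN not_sym])

text \<open>Bridges the two integration theories in play: substitution and the Gamma integral come
  from gauge integrals and completed Lebesgue measure, while Fubini and dominated convergence are
  run over \<open>lborel\<close>.\<close>

lemma borel_set_integrable_iff:
  fixes f :: "real \<Rightarrow> complex"
  assumes "set_borel_measurable lborel S f"
  shows "f absolutely_integrable_on S \<longleftrightarrow> set_integrable lborel S f"
  using assms unfolding set_integrable_def set_borel_measurable_def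
  by (rule integrable_completion)

lemma Gamma_integral_lborel:
  assumes "Re a > 0"
  shows "has_bochner_integral lborel (\<lambda>x. indicator {0<..} x *\<^sub>R (rpow x (a - 1) * of_real (exp (- x)))) (Gamma a)"
proof -
  let ?f = "\<lambda>x. rpow x (a - 1) * of_real (exp (- x)) :: complex"
  have eq: "?f x = of_real x powr (a - 1) / of_real (exp x)" if "x \<in> {0<..}" for x
    using that by (simp add: rpow_eq_powr exp_minus field_simps flip: of_real_inverse)
  have "?f absolutely_integrable_on {0<..}"
    using absolutely_integrable_Gamma_integral[OF assms, of 1]
    by (subst set_integrable_cong[OF refl refl eq]) auto
  moreover have "(?f has_integral Gamma a) {0<..}"
    using Gamma_integral_complex'[OF assms] eq
    by (subst has_integral_cong[of _ _ "\<lambda>x. of_real x powr (a - 1) / of_real (exp x)"]) auto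
  ultimately have "set_integrable lborel {0<..} ?f" "integral {0<..} ?f = Gamma a"
    using borel_set_integrable_iff[of "{0<..}" ?f]
    by (auto simp: set_borel_measurable_def integral_unique)
  thus ?thesis
    using set_borel_integral_eq_integral(2)[of "{0<..}" ?f]
    by (simp add: has_bochner_integral_iff set_integrable_def set_lebesgue_integral_def)
qed

lemma Beta_integrable_lborel:
  assumes "Re a > 0" "Re b > 0"
  shows "set_integrable lborel {0<..<1} (\<lambda>t. rpow t (a - 1) * rpow (1 - t) (b - 1))"
proof -
  have "set_integrable lborel {0<..<1} (\<lambda>t. t powr (Re a - 1) * (1 - t) powr (Re b - 1))"
    by (rule set_integrable_subset[OF integrable_Beta]) (use assms in auto)
  thus ?thesis unfolding set_integrable_def
    by (rule Bochner_Integration.integrable_bound)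
       (auto simp: indicator_def norm_mult norm_rpow intro!: AE_I2)
qed

text \<open>The product of two Gamma integrals is the total mass of the convolution of
  \<open>G a\<close> and \<open>G b\<close>. Scaling \<open>x = u * v\<close> shows that the
  convolution at \<open>u\<close> is \<open>B * G (a + b) u\<close>, since the exponentials combine
  to one in \<open>u\<close> alone. Cutting \<open>G\<close> off to \<open>{0<..}\<close> makes the
  convolution a plain integral over the line, restricted automatically to
  \<open>0 < v < 1\<close>.\<close>

lemma Beta_integral_lborel:
  assumes a: "Re a > 0" and b: "Re b > 0"
  shows "(LINT t:{0<..<1}|lborel. rpow t (a - 1) * rpow (1 - t) (b - 1)) = Beta a b"
proof -
  define B where "B = (LINT t:{0<..<1}|lborel. rpow t (a - 1) * rpow (1 - t) (b - 1))"
  define G where "G = (\<lambda>a x. indicator {0<..} x *\<^sub>R (rpow x (a - 1) * of_real (exp (- x))))"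
  have G: "integrable lborel (G z)" "integral\<^sup>L lborel (G z) = Gamma z" if "Re z > 0" for z
    using Gamma_integral_lborel[OF that] by (auto simp: G_def has_bochner_integral_iff)
  have [measurable]: "G z \<in> borel_measurable borel" for z
    unfolding G_def by measurable
  have shift_int: "integrable lborel (\<lambda>u. G b (u - x))" for x
    using lborel_integrable_real_affine[OF G(1)[OF b], of 1 "-x"] by (simp add: algebra_simps)
  have shift: "(LINT u|lborel. G b (u - x)) = Gamma b" for x
    using lborel_integral_real_affine[of 1 "G b" "-x"] G(2)[OF b] by (simp add: algebra_simps)
  have nshift: "(LINT u|lborel. norm (G b (u - x))) = (LINT u|lborel. norm (G b u))" for x
    using lborel_integral_real_affine[of 1 "\<lambda>u. norm (G b u)" "-x"] by (simp add: algebra_simps)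
  have joint: "integrable (lborel \<Otimes>\<^sub>M lborel) (\<lambda>(x, u). G a x * G b (u - x))"
  proof (rule lborel_pair.Fubini_integrable)
    show "integrable lborel (\<lambda>x. LINT y|lborel. norm (case (x, y) of (x, u) \<Rightarrow> G a x * G b (u - x)))"
      using G(1)[OF a] by (simp add: norm_mult nshift)
    show "AE x in lborel. integrable lborel (\<lambda>y. case (x, y) of (x, u) \<Rightarrow> G a x * G b (u - x))"
      by (intro AE_I2) (simp add: shift_int)
  qed measurable
  have "Gamma a * Gamma b = (LINT x|lborel. LINT u|lborel. G a x * G b (u - x))"
    using G[OF a] by (simp add: shift)
  also have "\<dots> = (LINT u|lborel. LINT x|lborel. G a x * G b (u - x))"
    by (rule lborel_pair.Fubini_integral[symmetric]) (use joint in simp)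
  also have "\<dots> = (LINT u|lborel. B * G (a + b) u)"
  proof (rule Bochner_Integration.integral_cong[OF refl])
    fix u :: real
    show "(LINT x|lborel. G a x * G b (u - x)) = B * G (a + b) u"
    proof (cases "u > 0")
      case False
      hence "G a x * G b (u - x) = 0" for x by (auto simp: G_def indicator_def)
      hence "(LINT x|lborel. G a x * G b (u - x)) = 0" by (simp only: integral_zero)
      with False show ?thesis by (simp add: G_def)
    next
      case True
      \<comment> \<open>The Jacobian \<open>u\<close> is absorbed at the end by the
        \<open>/ of_real u\<close> that arises from adding the exponents \<open>a - 1\<close> and
        \<open>b - 1\<close>.\<close>
      have "(LINT x|lborel. G a x * G b (u - x)) =
            u *\<^sub>R (LINT v|lborel. G a (u * v) * G b (u - u * v))"
        using True lborel_integral_real_affine[of u "\<lambda>x. G a x * G b (u - x)" 0] by simp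
      also have "(\<lambda>v. G a (u * v) * G b (u - u * v)) =
         (\<lambda>v. (rpow u (a + b - 1) / of_real u * of_real (exp (- u))) *
             (indicator {0<..<1} v *\<^sub>R (rpow v (a - 1) * rpow (1 - v) (b - 1))))"
      proof
        fix v :: real
        show "G a (u * v) * G b (u - u * v) = (rpow u (a + b - 1) / of_real u * of_real (exp (- u))) *
             (indicator {0<..<1} v *\<^sub>R (rpow v (a - 1) * rpow (1 - v) (b - 1)))"
        proof (cases "0 < v \<and> v < 1")
          case v: True
          have pos: "u * v > 0" "u - u * v > 0" using True v by auto
          have e1: "rpow (u - u * v) (b - 1) = rpow u (b - 1) * rpow (1 - v) (b - 1)"
            using True v rpow_mult[of u "1 - v" "b - 1"] by (simp add: algebra_simps)
          have e2: "rpow (u * v) (a - 1) = rpow u (a - 1) * rpow v (a - 1)"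
            using True v by (simp add: rpow_mult)
          have e3: "rpow u (a - 1) * rpow u (b - 1) = rpow u (a + b - 1) / of_real u"
            using True by (simp add: rpow_diff rpow_add rpow_one)
          have "exp (- (u * v)) * exp (- (u - u * v)) = exp (- u)"
            by (simp flip: exp_add)
          hence e4: "complex_of_real (exp (- (u * v))) * of_real (exp (- (u - u * v))) = of_real (exp (- u))"
            by (metis of_real_mult)
          have "G a (u * v) * G b (u - u * v) =
              (rpow (u * v) (a - 1) * rpow (u - u * v) (b - 1)) *
              (of_real (exp (- (u * v))) * of_real (exp (- (u - u * v))))"
            using pos by (simp only: G_def) simp
          also have "\<dots> = (rpow u (a - 1) * rpow u (b - 1)) * (rpow v (a - 1) * rpow (1 - v) (b - 1)) *
              of_real (exp (- u))"
            unfolding e1 e2 e4 by (simp only: mult_ac)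
          also note e3
          finally show ?thesis using v by simp
        next
          case v: False
          hence "\<not> (u * v > 0 \<and> u - u * v > 0)" using True
            by (auto simp: zero_less_mult_iff)
          with v show ?thesis by (auto simp: G_def indicator_def)
        qed
      qed
      also have "(LINT v|lborel. rpow u (a + b - 1) / of_real u * of_real (exp (- u)) *
             (indicator {0<..<1} v *\<^sub>R (rpow v (a - 1) * rpow (1 - v) (b - 1)))) =
           rpow u (a + b - 1) / of_real u * of_real (exp (- u)) * B"
        unfolding B_def set_lebesgue_integral_def by (rule integral_mult_right_zero)
      finally show ?thesis using True by (simp add: G_def scaleR_conv_of_real)
    qed
  qed
  also have "\<dots> = B * Gamma (a + b)"
    using G(2)[of "a + b"] a b by simp
  finally have *: "Gamma a * Gamma b = B * Gamma (a + b)" .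
  have "a + b \<notin> \<int>\<^sub>\<le>\<^sub>0"
    using a b by (auto elim!: nonpos_Ints_cases simp: complex_eq_iff)
  hence "Gamma (a + b) \<noteq> 0" by (simp add: Gamma_eq_zero_iff)
  with * show ?thesis by (simp add: B_def Beta_def field_simps)
qed

subsection \<open>The Fourier transform of the kernel 1 / (cosh s + cosh u)\<close>

lemma cosh_measurable [measurable]: "(cosh :: real \<Rightarrow> real) \<in> borel_measurable borel"
  by (intro borel_measurable_continuous_onI continuous_intros)

lemma sinh_measurable [measurable]: "(sinh :: real \<Rightarrow> real) \<in> borel_measurable borel"
  by (intro borel_measurable_continuous_onI continuous_intros)

lemma one_plus_cosh_exp: "1 / (1 + cosh u) = 2 * exp u / (1 + exp u)\<^sup>2" for u :: real
proof -
  have "1 + cosh u = (1 + exp u)\<^sup>2 / (2 * exp u)"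
    by (simp add: cosh_def power2_eq_square field_simps exp_minus)
  thus ?thesis by simp
qed

text \<open>The logistic substitution \<open>v = exp u / (1 + exp u)\<close> maps the line onto
  \<open>{0<..<1}\<close>, and its derivative is half of \<open>1 / (1 + cosh u)\<close>. Since
  \<open>v / (1 - v) = exp u\<close>, the oscillation becomes \<open>v^(im) (1 - v)^(-im)\<close>,
  so the integral is twice a Beta value at conjugate parameters.\<close>

lemma fourier_sech_sq:
  assumes m: "m > (0::real)"
  shows "has_bochner_integral lborel (\<lambda>u. exp (\<i> * of_real (m * u)) / of_real (1 + cosh u))
           (of_real (2 * pi * m / sinh (pi * m)))"
proof -
  define g where "g = (\<lambda>u::real. exp u / (1 + exp u))"
  define g' where "g' = (\<lambda>u::real. exp u / (1 + exp u)\<^sup>2)"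
  define f where "f = (\<lambda>v. rpow v (1 + \<i> * m - 1) * rpow (1 - v) (1 - \<i> * m - 1))"
  have [simp]: "1 + exp u \<noteq> 0" for u :: real
    using exp_gt_zero[of u] by linarith
  have g1: "1 - g u = 1 / (1 + exp u)" for u by (simp add: g_def field_simps)
  have img: "range g = {0<..<1}"
  proof safe
    fix u show "g u \<in> {0<..<1}" by (simp add: g_def add_pos_pos)
  next
    fix v :: real assume v: "v \<in> {0<..<1}"
    hence "g (ln (v / (1 - v))) = v" by (simp add: g_def field_simps)
    thus "v \<in> range g" by (metis rangeI)
  qed
  have inj: "inj g"
  proof (rule injI)
    fix x y assume "g x = g y"
    hence "1 - g x = 1 - g y" by simp
    thus "x = y" unfolding g1 by simp
  qed
  have der: "(g has_real_derivative g' u) (at u within UNIV)" for u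
    unfolding g_def g'_def
    by (auto intro!: derivative_eq_intros simp: power2_eq_square field_simps)
  have fg: "\<bar>g' u\<bar> *\<^sub>R f (g u) = exp (\<i> * of_real (m * u)) / of_real (1 + cosh u) / 2" for u
  proof -
    have "f (g u) = exp (\<i> * m * of_real (ln (g u) - ln (1 - g u)))"
      by (simp add: f_def rpow_def algebra_simps exp_add exp_diff exp_minus divide_inverse)
    also have "ln (g u) - ln (1 - g u) = u"
      by (simp add: g1) (simp add: g_def ln_div add_pos_pos)
    finally have fu: "f (g u) = exp (\<i> * of_real (m * u))" by (simp add: mult_ac)
    have "\<bar>g' u\<bar> = (1 / (1 + cosh u)) / 2"
      by (simp add: one_plus_cosh_exp g'_def)
    thus ?thesis unfolding fu by (simp add: scaleR_conv_of_real)
  qed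
  have Re1: "Re (1 + \<i> * m) > 0" "Re (1 - \<i> * m) > 0" by auto
  have meas: "set_borel_measurable lborel {0<..<1} f"
    unfolding set_borel_measurable_def f_def by measurable
  have si: "set_integrable lborel {0<..<1} f"
    using Beta_integrable_lborel[OF Re1] by (simp add: f_def)
  have "f absolutely_integrable_on g ` UNIV \<and> integral (g ` UNIV) f = Beta (1 + \<i> * m) (1 - \<i> * m)"
    using si Beta_integral_lborel[OF Re1] set_borel_integral_eq_integral(2)[OF si]
          borel_set_integrable_iff[OF meas] unfolding img by (simp add: f_def)
  hence *: "(\<lambda>u. \<bar>g' u\<bar> *\<^sub>R f (g u)) absolutely_integrable_on UNIV \<and>
         integral UNIV (\<lambda>u. \<bar>g' u\<bar> *\<^sub>R f (g u)) = Beta (1 + \<i> * m) (1 - \<i> * m)"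
    by (subst has_absolute_integral_change_of_variables_real[of _ g]) (use der inj in auto)
  \<comment> \<open>As \<open>Gamma 2 = 1\<close>, the Beta value is the product of two Gamma
    values, which the functional equation and the reflection formula turn into a hyperbolic
    sine.\<close>
  have Beta_eq: "Beta (1 + \<i> * m) (1 - \<i> * m) = of_real (pi * m / sinh (pi * m))"
  proof -
    have "Gamma (\<i> * m + 1) = \<i> * m * Gamma (\<i> * m)"
      using m by (intro Gamma_plus1) (auto elim!: nonpos_Ints_cases simp: complex_eq_iff)
    hence "Gamma (1 + \<i> * m) * Gamma (1 - \<i> * m) = \<i> * m * (Gamma (\<i> * m) * Gamma (1 - \<i> * m))"
      by (simp add: add.commute)
    also have "\<dots> = \<i> * m * (of_real pi / sin (of_real pi * (\<i> * m)))"
      by (subst Gamma_reflection_complex) simp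
    also have "sin (of_real pi * (\<i> * m)) = \<i> * sinh (of_real (pi * m))"
      by (simp add: sinh_conv_sin mult_ac)
    finally have "Gamma (1 + \<i> * m) * Gamma (1 - \<i> * m) = of_real pi * m / sinh (complex_of_real (pi * m))"
      by simp
    moreover have "sinh (complex_of_real (pi * m)) = of_real (sinh (pi * m))"
      by (simp add: sinh_field_def flip: exp_of_real)
    ultimately have "Gamma (1 + \<i> * m) * Gamma (1 - \<i> * m) = of_real (pi * m / sinh (pi * m))"
      by simp
    thus ?thesis using Gamma_fact[of 1, where 'a = complex] by (simp add: Beta_def)
  qed
  have "set_borel_measurable lborel UNIV (\<lambda>u. exp (\<i> * of_real (m * u)) / of_real (1 + cosh u) / 2)"
    unfolding set_borel_measurable_def by measurable
  with * have si2: "set_integrable lborel UNIV (\<lambda>u. exp (\<i> * of_real (m * u)) / of_real (1 + cosh u) / 2)"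
    unfolding fg by (subst (asm) borel_set_integrable_iff) auto
  have "integrable lborel (\<lambda>u. exp (\<i> * of_real (m * u)) / of_real (1 + cosh u) / 2)"
    "(LINT u|lborel. exp (\<i> * of_real (m * u)) / of_real (1 + cosh u) / 2) = of_real (pi * m / sinh (pi * m))"
    using si2 set_borel_integral_eq_integral(2)[OF si2] * Beta_eq unfolding fg
    by (simp_all add: set_integrable_def set_lebesgue_integral_def)
  moreover define X where "X = (\<lambda>u. exp (\<i> * of_real (m * u)) / of_real (1 + cosh u))"
  ultimately have "has_bochner_integral lborel (\<lambda>u. X u / 2) (of_real (pi * m / sinh (pi * m)))"
    by (simp only: has_bochner_integral_iff)
  from has_bochner_integral_mult_right[OF this, of 2]
  have "has_bochner_integral lborel X (of_real (2 * pi * m / sinh (pi * m)))"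
    by (simp add: mult.assoc)
  thus ?thesis by (simp only: X_def)
qed

text \<open>Taking norms at frequency 1 removes the oscillation, so integrability is read off from
  the transform.\<close>

lemma integrable_inverse_one_plus_cosh: "integrable lborel (\<lambda>u::real. 1 / (1 + cosh u))"
proof -
  have "integrable lborel (\<lambda>u. norm (exp (\<i> * of_real (1 * u)) / of_real (1 + cosh u)))"
    using fourier_sech_sq[of 1] by (intro integrable_norm) (auto simp: has_bochner_integral_iff)
  also have "(\<lambda>u::real. norm (exp (\<i> * of_real (1 * u)) / of_real (1 + cosh u))) = (\<lambda>u. 1 / (1 + cosh u))"
    by (intro ext) (simp add: norm_divide abs_of_pos add_pos_pos del: of_real_add)
  finally show ?thesis .
qed

lemma integrable_inverse_cosh_plus_cosh:
  "integrable lborel (\<lambda>u::real. 1 / (cosh s + cosh u))"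
proof (rule Bochner_Integration.integrable_bound[OF integrable_inverse_one_plus_cosh])
  show "AE u in lborel. norm (1 / (cosh s + cosh u)) \<le> norm (1 / (1 + cosh u))"
  proof (intro AE_I2)
    fix u :: real
    have "1 + cosh u > 0" "1 + cosh u \<le> cosh s + cosh u"
      using cosh_real_ge_1[of s] cosh_real_ge_1[of u] by linarith+
    thus "norm (1 / (cosh s + cosh u)) \<le> norm (1 / (1 + cosh u))"
      by (simp add: frac_le)
  qed
qed measurable

text \<open>The kernel \<open>W\<close> is half a difference of translates of
  \<open>tanh (u / 2)\<close>, so its derivative is half a difference of translates of
  \<open>h\<close>, whose transform is known. Translation multiplies a transform by a phase, the two
  phases differ by \<open>-2 i sin (m s)\<close>, and integration by parts divides by
  \<open>i m\<close>.\<close>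

lemma fourier_cosh_kernel_complex:
  assumes m: "m > (0::real)" and s: "s > (0::real)"
  shows "(LINT u|lborel. exp (\<i> * of_real (m * u)) * of_real (sinh s / (cosh s + cosh u))) =
           of_real (2 * pi * sin (m * s) / sinh (pi * m))"
proof -
  define E where "E = (\<lambda>u::real. exp (\<i> * of_real (m * u)))"
  define W where "W = (\<lambda>u::real. sinh s / (cosh s + cosh u))"
  define h where "h = (\<lambda>u::real. 1 / (1 + cosh u))"
  define H where "H = complex_of_real (2 * pi * m / sinh (pi * m))"
  have pos: "cosh s + cosh u > 0" for u :: real by (intro add_pos_pos) auto
  have pos': "cosh s + cosh u \<noteq> 0" for u :: real using pos[of u] by simp
  have W_tanh: "W u = (tanh ((u + s) / 2) - tanh ((u - s) / 2)) / 2" for u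
  proof -
    define p where "p = (u + s) / 2"
    define q where "q = (u - s) / 2"
    have "s = p - q" "u = p + q" by (simp_all add: p_def q_def field_simps)
    hence "W u = sinh (p - q) / (cosh (p - q) + cosh (p + q))" by (simp add: W_def)
    also have "\<dots> = (tanh p - tanh q) / 2"
      by (simp add: sinh_diff cosh_add cosh_diff tanh_def field_simps)
    finally show ?thesis by (simp add: p_def q_def)
  qed
  have h_sech: "h v = (1 - tanh (v / 2) ^ 2) / 2" for v
  proof -
    have "1 + cosh v = 2 * cosh (v / 2) ^ 2"
      using cosh_double_cosh[of "v / 2"] by simp
    moreover have "1 - tanh (v / 2) ^ 2 = (cosh (v / 2) ^ 2 - sinh (v / 2) ^ 2) / cosh (v / 2) ^ 2"
      by (simp add: tanh_def power_divide diff_divide_distrib)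
    hence "1 - tanh (v / 2) ^ 2 = 1 / cosh (v / 2) ^ 2"
      by (simp add: cosh_square_eq)
    ultimately show ?thesis by (simp add: h_def)
  qed
  have derW: "(W has_real_derivative (h (u + s) - h (u - s)) / 2) (at u)" for u
  proof -
    have "((\<lambda>u. (tanh ((u + s) / 2) - tanh ((u - s) / 2)) / 2) has_real_derivative (h (u + s) - h (u - s)) / 2) (at u)"
      unfolding h_sech by (auto intro!: derivative_eq_intros simp: field_simps)
    thus ?thesis unfolding W_tanh[symmetric, abs_def] by (simp add: fun_eq_iff W_tanh[symmetric])
  qed
  have derE: "(E has_vector_derivative \<i> * m * E u) (at u)" for u
  proof -
    have "((\<lambda>u. \<i> * m * of_real u) has_vector_derivative \<i> * m * of_real 1) (at u)"
      by (intro has_vector_derivative_mult_right has_vector_derivative_of_real) simp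
    hence "((exp \<circ> (\<lambda>u. \<i> * m * of_real u)) has_vector_derivative (\<i> * m * of_real 1) * exp (\<i> * m * of_real u)) (at u)"
      by (rule field_vector_diff_chain_at) (rule DERIV_exp)
    thus ?thesis by (simp add: E_def o_def mult.assoc)
  qed
  have nE: "norm (E u) = 1" for u by (simp add: E_def)
  have [measurable]: "E \<in> borel_measurable borel" "W \<in> borel_measurable borel" "h \<in> borel_measurable borel"
    unfolding E_def W_def h_def by measurable
  have intEh: "has_bochner_integral lborel (\<lambda>u. E u * of_real (h u)) H"
    using fourier_sech_sq[OF m] by (simp add: E_def h_def H_def)
  have intW: "integrable lborel (\<lambda>u. E u * of_real (W u))"
  proof (rule Bochner_Integration.integrable_bound)
    show "integrable lborel (\<lambda>u. sinh s * (1 / (cosh s + cosh u)))"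
      by (intro integrable_mult_right integrable_inverse_cosh_plus_cosh)
  qed (auto intro!: AE_I2 simp: norm_mult nE W_def simp del: of_real_divide of_real_add)
  have shift: "has_bochner_integral lborel (\<lambda>u. E u * of_real (h (u + c))) (E (- c) * H)" for c
  proof -
    have "has_bochner_integral lborel (\<lambda>u. E (c + 1 * u) * of_real (h (c + 1 * u))) H"
      using lborel_integrable_real_affine[of "\<lambda>u. E u * of_real (h u)" 1 c]
            lborel_integral_real_affine[of 1 "\<lambda>u. E u * of_real (h u)" c] intEh
      by (simp add: has_bochner_integral_iff)
    from has_bochner_integral_mult_right[OF this, of "E (- c)"]
    show ?thesis by (simp add: E_def exp_add[symmetric] algebra_simps)
  qed
  have E_diff: "E (- s) - E s = - 2 * \<i> * sin (m * s)"
    by (simp add: E_def complex_eq_iff Re_exp Im_exp)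
  \<comment> \<open>\<open>f\<close> is the derivative of \<open>E * W\<close>. As \<open>W\<close>
    vanishes at both infinities, its integral over the line is zero, which is the integration by
    parts.\<close>
  define f where "f = (\<lambda>u. \<i> * m * (E u * of_real (W u)) + (E u * of_real (h (u + s)) - E u * of_real (h (u + - s))) / 2)"
  have intf: "has_bochner_integral lborel f
      (\<i> * m * (LINT u|lborel. E u * of_real (W u)) + (E (- s) * H - E (- (- s)) * H) / 2)"
    unfolding f_def
    by (intro has_bochner_integral_add has_bochner_integral_mult_right has_bochner_integral_divide_zero
              has_bochner_integral_diff shift has_bochner_integral_integrable intW)
  have "(LBINT u=-\<infinity>..\<infinity>. f u) = 0 - 0"
  proof (rule interval_integral_FTC_integrable)
    fix u :: real
    show "((\<lambda>u. E u * of_real (W u)) has_vector_derivative f u) (at u)"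
    proof -
      have "((\<lambda>u. E u * of_real (W u)) has_vector_derivative
           E u * of_real ((h (u + s) - h (u - s)) / 2) + \<i> * m * E u * of_real (W u)) (at u)"
        by (intro has_vector_derivative_mult derE has_vector_derivative_of_real)
           (use derW[of u] in \<open>simp add: has_real_derivative_iff_has_vector_derivative\<close>)
      thus ?thesis by (simp add: f_def algebra_simps diff_divide_distrib)
    qed
    show "isCont f u"
    proof -
      have "1 + cosh v \<noteq> 0" for v :: real using cosh_real_ge_1[of v] by linarith
      thus ?thesis unfolding f_def E_def W_def h_def using pos' by (intro continuous_intros) auto
    qed
  next
    show "set_integrable lborel (einterval (- \<infinity>) \<infinity>) f"
      using intf by (simp add: has_bochner_integral_iff set_integrable_def)
    have top: "(W \<longlongrightarrow> 0) at_top" "(W \<longlongrightarrow> 0) at_bot"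
      unfolding W_def
      by (rule tendsto_divide_0[OF tendsto_const], rule filterlim_at_top_imp_at_infinity,
          rule filterlim_tendsto_add_at_top[OF tendsto_const], rule cosh_real_at_top cosh_real_at_bot)+
    have "((\<lambda>u. E u * of_real (W u)) \<longlongrightarrow> 0) F" if "(W \<longlongrightarrow> 0) F" for F
      by (rule Lim_null_comparison[OF always_eventually tendsto_norm_zero[OF that]])
         (simp add: norm_mult nE)
    with top show "(((\<lambda>u. E u * of_real (W u)) \<circ> real_of_ereal) \<longlongrightarrow> 0) (at_right (- \<infinity>))"
      "(((\<lambda>u. E u * of_real (W u)) \<circ> real_of_ereal) \<longlongrightarrow> 0) (at_left \<infinity>)"
      by (auto simp: ereal_tendsto_simps)
  qed simp
  hence "(LINT u|lborel. f u) = 0"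
    by (simp add: interval_lebesgue_integral_def set_lebesgue_integral_def)
  hence "\<i> * m * (LINT u|lborel. E u * of_real (W u)) + (E (- s) * H - E (- (- s)) * H) / 2 = 0"
    using intf by (simp add: has_bochner_integral_iff)
  hence "\<i> * m * (LINT u|lborel. E u * of_real (W u)) = - ((E (- s) - E s) * H / 2)"
    by (simp add: algebra_simps eq_neg_iff_add_eq_0 diff_divide_distrib)
  also have "\<dots> = \<i> * m * of_real (2 * pi * sin (m * s) / sinh (pi * m))"
    unfolding E_diff H_def by simp
  finally have "(LINT u|lborel. E u * of_real (W u)) = of_real (2 * pi * sin (m * s) / sinh (pi * m))"
    using m by (subst (asm) mult_cancel_left) simp
  thus ?thesis by (simp only: E_def W_def)
qed

text \<open>Real part of the complex formula; evenness of the integrand halves the integral over the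
  line, the origin being a null set.\<close>

lemma fourier_cosh_kernel:
  assumes m: "m > (0::real)" and s: "s > (0::real)"
  shows "(LINT u:{0<..}|lborel. cos (m * u) / (cosh s + cosh u)) =
           pi * sin (m * s) / (sinh s * sinh (pi * m))"
proof -
  define c where "c = (\<lambda>u. cos (m * u) / (cosh s + cosh u))"
  have c_minus: "c (- u) = c u" for u by (simp add: c_def)
  have [measurable]: "c \<in> borel_measurable borel" unfolding c_def by measurable
  have ic: "integrable lborel c"
  proof (rule Bochner_Integration.integrable_bound[OF integrable_inverse_cosh_plus_cosh[of s]])
    show "AE x in lborel. norm (c x) \<le> norm (1 / (cosh s + cosh x))"
      by (intro AE_I2) (auto simp: c_def intro!: divide_right_mono)
  qed measurable
  have ie: "integrable lborel (\<lambda>u. exp (\<i> * of_real (m * u)) * of_real (sinh s / (cosh s + cosh u)))"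
  proof (rule Bochner_Integration.integrable_bound)
    show "integrable lborel (\<lambda>u. sinh s * (1 / (cosh s + cosh u)))"
      by (intro integrable_mult_right integrable_inverse_cosh_plus_cosh)
  qed (auto intro!: AE_I2 simp: norm_mult simp del: of_real_divide of_real_add of_real_mult)
  have "Re (LINT u|lborel. exp (\<i> * of_real (m * u)) * of_real (sinh s / (cosh s + cosh u))) =
        (LINT u|lborel. Re (exp (\<i> * of_real (m * u)) * of_real (sinh s / (cosh s + cosh u))))"
    using ie by (rule integral_Re[symmetric])
  also have "(\<lambda>u. Re (exp (\<i> * of_real (m * u)) * of_real (sinh s / (cosh s + cosh u)))) = (\<lambda>u. sinh s * c u)"
    by (intro ext) (simp add: c_def Re_exp del: of_real_add of_real_divide of_real_mult)
  finally have full: "sinh s * (LINT u|lborel. c u) = 2 * pi * sin (m * s) / sinh (pi * m)"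
    unfolding fourier_cosh_kernel_complex[OF m s] by simp
  have "(LINT u|lborel. c u) = (LINT u|lborel. indicator {0<..} u *\<^sub>R c u + indicator {..<0} u *\<^sub>R c u)"
    by (rule integral_cong_AE)
       (auto simp: indicator_def intro!: eventually_mono[OF AE_lborel_singleton[of 0]])
  also have "\<dots> = (LINT u:{0<..}|lborel. c u) + (LINT u:{..<0}|lborel. c u)"
    unfolding set_lebesgue_integral_def
    by (intro Bochner_Integration.integral_add integrable_mult_indicator ic) auto
  also have "(LINT u:{..<0}|lborel. c u) = (LINT u:{0<..}|lborel. c u)"
    using lborel_integral_real_affine[of "-1" "\<lambda>u. indicator {..<0} u *\<^sub>R c u" 0]
    by (simp add: set_lebesgue_integral_def c_minus indicator_def)
  finally show ?thesis using full s m by (simp add: c_def field_simps)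
qed

subsection \<open>The hypergeometric function\<close>

definition hypcoeff :: "complex \<Rightarrow> complex \<Rightarrow> complex \<Rightarrow> nat \<Rightarrow> complex" where
  "hypcoeff a b c k = pochhammer a k * pochhammer b k / (pochhammer c k * fact k)"

lemma hyp2F1_altdef: "hyp2F1 a b c z = (\<Sum>k. hypcoeff a b c k * z ^ k)"
  by (simp add: hyp2F1_def hypcoeff_def)

text \<open>Cleared of denominators, the recurrence is the coefficient form of the hypergeometric
  equation.\<close>

lemma hypcoeff_Suc:
  assumes "c \<notin> \<int>\<^sub>\<le>\<^sub>0"
  shows "of_nat (Suc k) * (c + of_nat k) * hypcoeff a b c (Suc k) =
         (a + of_nat k) * (b + of_nat k) * hypcoeff a b c k"
proof -
  have "of_nat (Suc k) \<noteq> (0::complex)" by (simp only: of_nat_eq_0_iff)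
  moreover have "pochhammer c k \<noteq> 0" "c + of_nat k \<noteq> 0"
    using assms plus_of_nat_eq_0_imp[of c] by (auto simp: pochhammer_eq_0_iff)
  ultimately show ?thesis
    by (simp add: hypcoeff_def pochhammer_Suc divide_simps del: of_nat_Suc)
qed

lemma add_of_nat_ratio_tendsto:
  "(\<lambda>k. (a + of_nat k) / (c + of_nat k)) \<longlonglongrightarrow> (1::complex)"
proof -
  have inf: "filterlim (\<lambda>k. c + of_nat k :: complex) at_infinity sequentially"
    by (rule tendsto_add_filterlim_at_infinity[OF tendsto_const tendsto_of_nat])
  have "(\<lambda>k. 1 + (a - c) / (c + of_nat k)) \<longlonglongrightarrow> 1 + 0"
    by (intro tendsto_add tendsto_const tendsto_divide_0[OF tendsto_const inf])
  moreover have "eventually (\<lambda>k. c + of_nat k \<noteq> 0) sequentially"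
    using filterlim_at_infinity_imp_eventually_ne[OF inf, of 0] .
  hence "eventually (\<lambda>k. 1 + (a - c) / (c + of_nat k) = (a + of_nat k) / (c + of_nat k)) sequentially"
    by eventually_elim (simp add: field_simps)
  ultimately show ?thesis by (simp add: filterlim_cong)
qed

text \<open>The conditions on \<open>a\<close> and \<open>b\<close> keep all coefficients nonzero,
  so quotients of consecutive coefficients exist; they tend to 1, which fixes the radius of
  convergence.\<close>

lemma summable_hypcoeff:
  assumes a: "a \<notin> \<int>\<^sub>\<le>\<^sub>0" and b: "b \<notin> \<int>\<^sub>\<le>\<^sub>0" and c: "c \<notin> \<int>\<^sub>\<le>\<^sub>0" and z: "norm z < 1"
  shows "summable (\<lambda>k. norm (hypcoeff a b c k * z ^ k))"
proof -
  have nz: "pochhammer x k \<noteq> 0" "x + of_nat k \<noteq> 0" if "x \<notin> \<int>\<^sub>\<le>\<^sub>0" for x :: complex and k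
    using that plus_of_nat_eq_0_imp[of x] by (auto simp: pochhammer_eq_0_iff)
  have ratio: "hypcoeff a b c k / hypcoeff a b c (Suc k) =
     (c + of_nat k) / (a + of_nat k) * ((1 + of_nat k) / (b + of_nat k))" for k
    using nz[OF a] nz[OF b] nz[OF c]
    by (simp add: hypcoeff_def pochhammer_Suc divide_simps)
  have "(\<lambda>k. norm (hypcoeff a b c k / hypcoeff a b c (Suc k))) \<longlonglongrightarrow> norm (1 * 1 :: complex)"
    unfolding ratio by (intro tendsto_norm tendsto_mult add_of_nat_ratio_tendsto)
  hence lim: "(\<lambda>k. ereal (norm (hypcoeff a b c k) / norm (hypcoeff a b c (Suc k)))) \<longlonglongrightarrow> ereal 1"
    by (simp add: norm_divide)
  have "conv_radius (hypcoeff a b c) = ereal 1"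
    by (rule conv_radius_ratio_limit_ereal_nonzero[OF _ lim]) auto
  thus ?thesis using z by (intro abs_summable_in_conv_radius) simp
qed

text \<open>Termwise differentiation reduces the equation to the two-term recurrence. The
  derivatives are named as functions so that the chain rule applies after a hyperbolic argument is
  substituted.\<close>

lemma hyp2F1_ode:
  assumes a: "a \<notin> \<int>\<^sub>\<le>\<^sub>0" and b: "b \<notin> \<int>\<^sub>\<le>\<^sub>0" and c: "c \<notin> \<int>\<^sub>\<le>\<^sub>0"
  shows "\<exists>F1 F2. \<forall>z. norm z < 1 \<longrightarrow>
     (hyp2F1 a b c has_field_derivative F1 z) (at z) \<and> (F1 has_field_derivative F2 z) (at z) \<and>
     z * (1 - z) * F2 z + (c - (a + b + 1) * z) * F1 z - a * b * hyp2F1 a b c z = 0"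
proof -
  define h where "h = hypcoeff a b c"
  define F1 where "F1 = (\<lambda>z. \<Sum>k. diffs h k * z ^ k)"
  define F2 where "F2 = (\<lambda>z. \<Sum>k. diffs (diffs h) k * z ^ k)"
  have F0: "hyp2F1 a b c = (\<lambda>z. \<Sum>k. h k * z ^ k)"
    by (simp add: fun_eq_iff hyp2F1_altdef h_def)
  have s0: "summable (\<lambda>k. h k * z ^ k)" if "norm z < 1" for z
    using summable_hypcoeff[OF a b c that] unfolding h_def by (rule summable_norm_cancel)
  have s1: "summable (\<lambda>k. diffs h k * z ^ k)" if "norm z < 1" for z
    using s0 that by (rule termdiff_converges[rotated])
  have s2: "summable (\<lambda>k. diffs (diffs h) k * z ^ k)" if "norm z < 1" for z
    using s1 that by (rule termdiff_converges[rotated])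
  have d1: "(hyp2F1 a b c has_field_derivative F1 z) (at z)" if z: "norm z < 1" for z
  proof -
    obtain K where K: "norm z < K" "K < 1" using dense[OF z] by blast
    have "K > 0" using K norm_ge_zero[of z] by linarith
    with K show ?thesis unfolding F0 F1_def
      by (intro termdiffs_strong[of h "of_real K"] s0) auto
  qed
  have d2: "(F1 has_field_derivative F2 z) (at z)" if z: "norm z < 1" for z
  proof -
    obtain K where K: "norm z < K" "K < 1" using dense[OF z] by blast
    have "K > 0" using K norm_ge_zero[of z] by linarith
    with K show ?thesis unfolding F1_def F2_def
      by (intro termdiffs_strong[of "diffs h" "of_real K"] s1) auto
  qed
  have "z * (1 - z) * F2 z + (c - (a + b + 1) * z) * F1 z - a * b * hyp2F1 a b c z = 0"
    if z: "norm z < 1" for z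
  proof -
  have 0: "(\<lambda>k. h k * z ^ k) sums hyp2F1 a b c z"
    unfolding F0 using s0[OF z] by (rule summable_sums)
  have 1: "(\<lambda>k. diffs h k * z ^ k) sums F1 z"
    unfolding F1_def using s1[OF z] by (rule summable_sums)
  have 2: "(\<lambda>k. diffs (diffs h) k * z ^ k) sums F2 z"
    unfolding F2_def using s2[OF z] by (rule summable_sums)
  \<comment> \<open>Multiplying by \<open>z\<close> moves the indices up by one; the new zeroth term
    is zero because of the factor \<open>of_nat k\<close>.\<close>
  have shift: "f sums s" if "(\<lambda>k. f (Suc k)) sums s" "f 0 = 0" for f :: "nat \<Rightarrow> complex" and s
    using sums_Suc[OF that(1)] that(2) by simp
  have A: "(\<lambda>k. of_nat k * h k * z ^ k) sums (z * F1 z)"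
    by (rule shift) (use sums_mult[OF 1, of z] in \<open>simp_all add: diffs_def algebra_simps\<close>)
  have B: "(\<lambda>k. of_nat k * of_nat (Suc k) * h (Suc k) * z ^ k) sums (z * F2 z)"
    by (rule shift) (use sums_mult[OF 2, of z] in \<open>simp_all add: diffs_def algebra_simps\<close>)
  have C: "(\<lambda>k. (of_nat k - 1) * of_nat k * h k * z ^ k) sums (z * (z * F2 z))"
    by (rule shift) (use sums_mult[OF B, of z] in \<open>simp_all add: algebra_simps\<close>)
  have "(\<lambda>k. of_nat k * of_nat (Suc k) * h (Suc k) * z ^ k - (of_nat k - 1) * of_nat k * h k * z ^ k
      + c * (diffs h k * z ^ k) - (a + b + 1) * (of_nat k * h k * z ^ k) - a * b * (h k * z ^ k)) sums
      (z * F2 z - z * (z * F2 z) + c * F1 z - (a + b + 1) * (z * F1 z) - a * b * hyp2F1 a b c z)"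
    by (intro sums_add sums_diff sums_mult 0 1 A B C)
  also have "(\<lambda>k. of_nat k * of_nat (Suc k) * h (Suc k) * z ^ k - (of_nat k - 1) * of_nat k * h k * z ^ k
      + c * (diffs h k * z ^ k) - (a + b + 1) * (of_nat k * h k * z ^ k) - a * b * (h k * z ^ k)) = (\<lambda>k. 0)"
  proof
    fix k
    have "of_nat k * of_nat (Suc k) * h (Suc k) * z ^ k - (of_nat k - 1) * of_nat k * h k * z ^ k
      + c * (diffs h k * z ^ k) - (a + b + 1) * (of_nat k * h k * z ^ k) - a * b * (h k * z ^ k) =
      (of_nat (Suc k) * (c + of_nat k) * h (Suc k) - (a + of_nat k) * (b + of_nat k) * h k) * z ^ k"
      by (simp add: diffs_def algebra_simps)
    thus "of_nat k * of_nat (Suc k) * h (Suc k) * z ^ k - (of_nat k - 1) * of_nat k * h k * z ^ k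
      + c * (diffs h k * z ^ k) - (a + b + 1) * (of_nat k * h k * z ^ k) - a * b * (h k * z ^ k) = 0"
      using hypcoeff_Suc[OF c, of k a b] by (simp add: h_def)
  qed
  finally have "z * F2 z - z * (z * F2 z) + c * F1 z - (a + b + 1) * (z * F1 z) - a * b * hyp2F1 a b c z = 0"
    using sums_unique2 sums_zero by blast
  thus ?thesis
    by (simp add: algebra_simps)
  qed
  with d1 d2 show ?thesis by blast
qed

lemma half_not_nonpos_Int: "1/2 + \<i> * of_real m \<notin> \<int>\<^sub>\<le>\<^sub>0" "1/2 - \<i> * of_real m \<notin> \<int>\<^sub>\<le>\<^sub>0"
  by (auto elim!: nonpos_Ints_cases simp: complex_eq_iff)

text \<open>Under \<open>w = - sinh (z / 2)^2\<close> the hypergeometric equation becomes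
  \<open>U'' = - m^2 U\<close> for \<open>U z = cosh (z / 2) * F w\<close>. With
  \<open>U 0 = 1\<close> and \<open>U' 0 = 0\<close> the solution is the cosine. The bound on
  \<open>sinh (t / 2)\<close> keeps \<open>w\<close> inside the disc of convergence along all of
  \<open>{0..t}\<close>.\<close>

lemma cos_eq_hyp2F1:
  assumes m: "m \<noteq> (0::real)" and t: "t \<ge> 0" "sinh (t / 2) < (1::real)"
  shows "complex_of_real (cos (m * t)) = of_real (cosh (t / 2)) *
           hyp2F1 (1/2 - \<i> * m) (1/2 + \<i> * m) (1/2) (- of_real (sinh (t / 2) ^ 2))"
proof -
  define F where "F = hyp2F1 (1/2 - \<i> * m) (1/2 + \<i> * m) (1/2)"
  have half: "(1/2 :: complex) \<notin> \<int>\<^sub>\<le>\<^sub>0" using half_not_nonpos_Int(1)[of 0] by simp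
  obtain F1 F2 where FF: "\<forall>z. norm z < 1 \<longrightarrow>
      (F has_field_derivative F1 z) (at z) \<and> (F1 has_field_derivative F2 z) (at z) \<and>
      z * (1 - z) * F2 z + (1/2 - (1/2 - \<i> * m + (1/2 + \<i> * m) + 1) * z) * F1 z
        - (1/2 - \<i> * m) * (1/2 + \<i> * m) * F z = 0"
    using hyp2F1_ode[OF half_not_nonpos_Int(2)[of m] half_not_nonpos_Int(1)[of m] half, folded F_def]
    by (elim exE) (rule that)
  note F1 = FF[rule_format, THEN conjunct1] and F2 = FF[rule_format, THEN conjunct2, THEN conjunct1]
    and ode = FF[rule_format, THEN conjunct2, THEN conjunct2]
  define U where "U = (\<lambda>z. cosh (z / 2) * F (- (sinh (z / 2) ^ 2)))"
  define U1 where "U1 = (\<lambda>z. sinh (z / 2) / 2 * F (- (sinh (z / 2) ^ 2))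
      - sinh (z / 2) * cosh (z / 2) ^ 2 * F1 (- (sinh (z / 2) ^ 2)))"
  have cs: "cosh (z / 2) * cosh (z / 2) = 1 + sinh (z / 2) * sinh (z / 2)" for z :: complex
    using cosh_square_eq[of "z / 2"] by (simp add: power2_eq_square)
  have dU: "(U has_field_derivative U1 z) (at z)" if z: "norm (sinh (z / 2) ^ 2) < 1" for z
  proof -
    have "((\<lambda>z. F (- (sinh (z / 2) ^ 2))) has_field_derivative
            F1 (- (sinh (z / 2) ^ 2)) * - (sinh (z / 2) * cosh (z / 2))) (at z)"
      by (rule DERIV_chain2[OF F1]) (use z in \<open>auto intro!: derivative_eq_intros\<close>)
    thus ?thesis unfolding U_def U1_def
      by (auto intro!: derivative_eq_intros simp: power2_eq_square algebra_simps)
  qed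
  have dU1: "(U1 has_field_derivative - (of_real m ^ 2 * U z)) (at z)" if z: "norm (sinh (z / 2) ^ 2) < 1" for z
  proof -
    define C where "C = cosh (z / 2)"
    define S where "S = sinh (z / 2)"
    have CS: "C * C = 1 + S * S" using cs by (simp add: C_def S_def)
    have 1: "((\<lambda>z. F (- (sinh (z / 2) ^ 2))) has_field_derivative
            F1 (- (sinh (z / 2) ^ 2)) * - (sinh (z / 2) * cosh (z / 2))) (at z)"
      by (rule DERIV_chain2[OF F1]) (use z in \<open>auto intro!: derivative_eq_intros\<close>)
    have 2: "((\<lambda>z. F1 (- (sinh (z / 2) ^ 2))) has_field_derivative
            F2 (- (sinh (z / 2) ^ 2)) * - (sinh (z / 2) * cosh (z / 2))) (at z)"
      by (rule DERIV_chain2[OF F2]) (use z in \<open>auto intro!: derivative_eq_intros\<close>)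
    have dU1z: "(U1 has_field_derivative
       C / 4 * F (- (S ^ 2)) + S / 2 * (F1 (- (S ^ 2)) * - (S * C))
        - ((C / 2 * C ^ 2 + S * (S * C)) * F1 (- (S ^ 2)) + S * C ^ 2 * (F2 (- (S ^ 2)) * - (S * C)))) (at z)"
      unfolding U1_def C_def S_def
      by (insert 1 2, (rule derivative_eq_intros refl | assumption | simp)+) (simp add: field_simps power2_eq_square)
    have "C / 4 * F (- (S ^ 2)) + S / 2 * (F1 (- (S ^ 2)) * - (S * C))
        - ((C / 2 * C ^ 2 + S * (S * C)) * F1 (- (S ^ 2)) + S * C ^ 2 * (F2 (- (S ^ 2)) * - (S * C)))
        = C * (F (- (S ^ 2)) / 4 - (- (S ^ 2) * (C * C) * F2 (- (S ^ 2))
                + (S * S / 2 + C * C / 2 + S * S) * F1 (- (S ^ 2))))"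
      by (simp add: algebra_simps power2_eq_square)
    also have "\<dots> = C * (F (- (S ^ 2)) / 4 - (1/2 - \<i> * m) * (1/2 + \<i> * m) * F (- (S ^ 2)))"
    proof -
      have e: "S * S / 2 + C * C / 2 + S * S = 1/2 + 2 * (S * S)"
        unfolding CS by (simp add: field_simps)
      have "- (S ^ 2) * (C * C) * F2 (- (S ^ 2)) + (S * S / 2 + C * C / 2 + S * S) * F1 (- (S ^ 2)) =
        (1/2 - \<i> * m) * (1/2 + \<i> * m) * F (- (S ^ 2))"
        using ode[of "- (S ^ 2)"] z unfolding e unfolding CS
        by (simp add: S_def[symmetric] algebra_simps power2_eq_square)
      thus ?thesis by simp
    qed
    also have "\<dots> = - (of_real m ^ 2 * U z)"
      by (simp add: U_def C_def S_def algebra_simps power2_eq_square)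
    finally show ?thesis using dU1z by (simp only:)
  qed
  define c where "c = (\<lambda>x::real. complex_of_real (cos (m * x)))"
  define s where "s = (\<lambda>x::real. complex_of_real (sin (m * x)))"
  have small: "norm (sinh (complex_of_real x / 2) ^ 2) < 1" if "x \<in> {0..t}" for x
  proof -
    have "sinh (complex_of_real x / 2) = of_real (sinh (x / 2))"
      by (simp add: sinh_field_def flip: exp_of_real)
    moreover have "sinh (x / 2) \<le> sinh (t / 2)" "0 \<le> sinh (x / 2)" using that by auto
    hence "0 \<le> sinh (x / 2)" "sinh (x / 2) < 1" using t(2) by linarith+
    hence "sinh (x / 2) ^ 2 < 1" by (simp add: abs_square_less_1)
    ultimately show ?thesis by (simp add: norm_power)
  qed
  have c': "(c has_vector_derivative - (m * s x)) (at x within {0..t})" for x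
    unfolding c_def s_def
    by (rule has_vector_derivative_eq_rhs, rule has_vector_derivative_of_real)
       (auto intro!: derivative_eq_intros simp: has_real_derivative_iff_has_vector_derivative[symmetric])
  have s': "(s has_vector_derivative (m * c x)) (at x within {0..t})" for x
    unfolding c_def s_def
    by (rule has_vector_derivative_eq_rhs, rule has_vector_derivative_of_real)
       (auto intro!: derivative_eq_intros simp: has_real_derivative_iff_has_vector_derivative[symmetric])
  have u': "((\<lambda>x. U (of_real x)) has_vector_derivative U1 (of_real x)) (at x within {0..t})"
    if "x \<in> {0..t}" for x
    by (rule has_vector_derivative_real_field[OF dU[OF small[OF that]]])
  have u1': "((\<lambda>x. U1 (of_real x)) has_vector_derivative - (of_real m ^ 2 * U (of_real x))) (at x within {0..t})"
    if "x \<in> {0..t}" for x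
    by (rule has_vector_derivative_real_field[OF dU1[OF small[OF that]]])
  \<comment> \<open>Variation of constants: \<open>P\<close> and \<open>Q\<close> are the
    coordinates of the solution in the rotating basis of \<open>c\<close> and \<open>s\<close>,
    hence constant, and \<open>m * U\<close> is recovered as \<open>P * c + Q * s\<close>.\<close>
  define P where "P = (\<lambda>x. m * (U (of_real x) * c x) - U1 (of_real x) * s x)"
  define Q where "Q = (\<lambda>x. m * (U (of_real x) * s x) + U1 (of_real x) * c x)"
  have P': "(P has_vector_derivative 0) (at x within {0..t})" if "x \<in> {0..t}" for x
    unfolding P_def
    by (rule has_vector_derivative_eq_rhs,
        (rule has_vector_derivative_diff has_vector_derivative_mult_right has_vector_derivative_mult
              c' s' u'[OF that] u1'[OF that])+)
       (simp add: algebra_simps power2_eq_square)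
  have Q': "(Q has_vector_derivative 0) (at x within {0..t})" if "x \<in> {0..t}" for x
    unfolding Q_def
    by (rule has_vector_derivative_eq_rhs,
        (rule has_vector_derivative_add has_vector_derivative_mult_right has_vector_derivative_mult
              c' s' u'[OF that] u1'[OF that])+)
       (simp add: algebra_simps power2_eq_square)
  have F0: "F 0 = 1" unfolding F_def hyp2F1_altdef powser_zero by (simp add: hypcoeff_def)
  have const: "f t = f 0" if df: "\<And>x. x \<in> {0..t} \<Longrightarrow> (f has_vector_derivative 0) (at x within {0..t})"
    for f :: "real \<Rightarrow> complex"
  proof -
    obtain k where "\<And>x. x \<in> {0..t} \<Longrightarrow> f x = k"
      by (rule has_vector_derivative_zero_constant[of "{0..t}" f]) (use df in auto)
    thus ?thesis using t by simp
  qed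
  have "P t = P 0" "Q t = Q 0" by (rule const, erule P' Q')+
  hence P: "m * (U (of_real t) * c t) - U1 (of_real t) * s t = m"
    and Q: "m * (U (of_real t) * s t) + U1 (of_real t) * c t = 0"
    by (simp_all add: P_def Q_def c_def s_def U_def U1_def F0)
  have cs1: "c t * c t + s t * s t = 1"
    using sin_cos_squared_add3[of "m * t"] unfolding c_def s_def by (metis of_real_add of_real_mult of_real_1)
  have "m * U (of_real t) = m * U (of_real t) * (c t * c t + s t * s t)"
    by (simp add: cs1)
  also have "\<dots> = (m * (U (of_real t) * c t) - U1 (of_real t) * s t) * c t
      + (m * (U (of_real t) * s t) + U1 (of_real t) * c t) * s t"
    by (simp add: algebra_simps)
  also have "\<dots> = m * c t" unfolding P Q by simp
  finally have "c t = U (of_real t)" using m by simp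
  moreover have "sinh (complex_of_real t / 2) = of_real (sinh (t / 2))" "cosh (complex_of_real t / 2) = of_real (cosh (t / 2))"
    by (simp_all add: sinh_field_def cosh_field_def flip: exp_of_real)
  ultimately show ?thesis by (simp add: c_def U_def F_def)
qed

subsection \<open>Analytic continuation by an integral\<close>

declare csqrt.sel [simp del]

text \<open>The continuation of \<open>cos (m u) / cosh (u / 2)\<close> as a function of \<open>w = sinh (u / 2)^2\<close>: the argument
  of the logarithm is \<open>cosh u + sinh u\<close>.\<close>

definition mehler_kernel :: "real \<Rightarrow> complex \<Rightarrow> complex" where
  "mehler_kernel m w = cos (of_real m * Ln (1 + 2 * w + 2 * (csqrt w * csqrt (1 + w)))) / csqrt (1 + w)"

text \<open>Square roots of points of the right half plane have argument below pi/4 in modulus; a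
  product of two such roots therefore stays in the right half plane.\<close>

lemma Re_csqrt_gt_Im:
  assumes "Re z > 0"
  shows "\<bar>Im (csqrt z)\<bar> < Re (csqrt z)"
proof -
  have "Re z = (Re (csqrt z))\<^sup>2 - (Im (csqrt z))\<^sup>2"
    by (metis Re_power2 power2_csqrt)
  with assms have "(Im (csqrt z))\<^sup>2 < (Re (csqrt z))\<^sup>2" by linarith
  moreover have "Re (csqrt z) \<ge> 0" using Re_csqrt by blast
  ultimately show ?thesis by (metis power2_abs power2_less_imp_less)
qed

lemma Re_csqrt_product_pos:
  assumes "Re z > 0" "Re w > 0"
  shows "Re (csqrt z * csqrt w) > 0"
proof -
  have "\<bar>Im (csqrt z)\<bar> * \<bar>Im (csqrt w)\<bar> < Re (csqrt z) * Re (csqrt w)"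
    using Re_csqrt_gt_Im[OF assms(1)] Re_csqrt_gt_Im[OF assms(2)]
    by (intro mult_strict_mono') auto
  thus ?thesis by (simp add: abs_mult[symmetric])
qed

lemma not_nonpos_Real_if_Re_pos: "Re z > 0 \<Longrightarrow> z \<notin> \<real>\<^sub>\<le>\<^sub>0"
  by (auto simp: complex_nonpos_Reals_iff)

text \<open>On the right half plane every summand in the argument of the logarithm has positive real
  part, so no branch cut is met.\<close>

lemma holomorphic_mehler_kernel: "mehler_kernel m holomorphic_on {w. Re w > 0}"
proof -
  have "1 + 2 * w + 2 * (csqrt w * csqrt (1 + w)) \<notin> \<real>\<^sub>\<le>\<^sub>0" if "Re w > 0" for w
  proof (rule not_nonpos_Real_if_Re_pos)
    have "Re (csqrt w * csqrt (1 + w)) > 0"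
      by (rule Re_csqrt_product_pos) (use that in auto)
    moreover have "Re (1 + 2 * w + 2 * (csqrt w * csqrt (1 + w))) =
        1 + 2 * Re w + 2 * Re (csqrt w * csqrt (1 + w))"
      by (simp)
    ultimately show "Re (1 + 2 * w + 2 * (csqrt w * csqrt (1 + w))) > 0"
      using that by linarith
  qed
  moreover have "csqrt (1 + w) \<noteq> 0" if "Re w > 0" for w
  proof -
    have "1 + w \<noteq> 0" using that by (auto simp: complex_eq_iff)
    thus ?thesis by simp
  qed
  moreover have "w \<notin> \<real>\<^sub>\<le>\<^sub>0" "1 + w \<notin> \<real>\<^sub>\<le>\<^sub>0" if "Re w > 0" for w
    using that by (auto intro!: not_nonpos_Real_if_Re_pos)
  ultimately show ?thesis unfolding mehler_kernel_def
    by (intro holomorphic_intros) blast+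
qed

lemma norm_cos_le_exp: "norm (cos z) \<le> exp \<bar>Im z\<bar>" for z :: complex
proof -
  have "norm (cos z) = norm (exp (\<i> * z) + exp (- (\<i> * z))) / 2"
    by (simp add: cos_exp_eq norm_divide)
  also have "\<dots> \<le> (norm (exp (\<i> * z)) + norm (exp (- (\<i> * z)))) / 2"
    by (intro divide_right_mono norm_triangle_ineq) auto
  also have "\<dots> = (exp (- Im z) + exp (Im z)) / 2" by (simp add: norm_exp_eq_Re)
  also have "\<dots> \<le> (exp \<bar>Im z\<bar> + exp \<bar>Im z\<bar>) / 2"
    by (intro divide_right_mono add_mono) auto
  finally show ?thesis by simp
qed

text \<open>The logarithm has imaginary part at most pi in modulus, which bounds the cosine whatever
  the size of \<open>w\<close>, and the denominator is at least 1. Independence of \<open>w\<close>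
  is what makes truncated integrals converge uniformly.\<close>

lemma norm_mehler_kernel_le:
  assumes "Re w > 0"
  shows "norm (mehler_kernel m w) \<le> exp (\<bar>m\<bar> * pi)"
proof -
  define z where "z = 1 + 2 * w + 2 * (csqrt w * csqrt (1 + w))"
  have "1 < norm (1 + w)"
    using assms complex_Re_le_cmod[of "1 + w"] by simp
  hence 1: "norm (csqrt (1 + w)) \<ge> 1" by simp
  have "Re (csqrt w * csqrt (1 + w)) > 0"
    by (rule Re_csqrt_product_pos) (use assms in auto)
  moreover have "Re z = 1 + 2 * Re w + 2 * Re (csqrt w * csqrt (1 + w))"
    by (simp add: z_def)
  ultimately have "z \<noteq> 0" using assms by (auto simp: complex_eq_iff)
  hence "\<bar>Im (Ln z)\<bar> \<le> pi" using Im_Ln_le_pi[of z] mpi_less_Im_Ln[of z] by linarith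
  hence "\<bar>Im (of_real m * Ln z)\<bar> \<le> \<bar>m\<bar> * pi" by (simp add: abs_mult mult_left_mono)
  hence "norm (cos (of_real m * Ln z)) \<le> exp (\<bar>m\<bar> * pi)"
    by (intro order_trans[OF norm_cos_le_exp]) simp
  thus ?thesis using 1 unfolding mehler_kernel_def z_def[symmetric]
    using frac_le[of "exp (\<bar>m\<bar> * pi)" _ 1 "norm (csqrt (1 + w))"]
    by (simp only: norm_divide) simp
qed

lemma mehler_kernel_of_real:
  assumes "t \<ge> 0"
  shows "mehler_kernel m (of_real (sinh (t / 2) ^ 2)) = of_real (cos (m * t) / cosh (t / 2))"
proof -
  have s: "sinh (t / 2) \<ge> 0" using assms by simp
  have 1: "csqrt (of_real (sinh (t / 2) ^ 2)) = of_real (sinh (t / 2))"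
    using s by (subst csqrt_of_real_nonneg) auto
  have 2: "1 + complex_of_real (sinh (t / 2) ^ 2) = of_real (cosh (t / 2) ^ 2)"
    by (simp add: cosh_square_eq)
  have 3: "csqrt (of_real (cosh (t / 2) ^ 2)) = of_real (cosh (t / 2))"
    by (subst csqrt_of_real_nonneg) auto
  have e: "1 + 2 * sinh (t / 2) ^ 2 + 2 * (sinh (t / 2) * cosh (t / 2)) = exp t"
    using cosh_double[of "t / 2"] sinh_double[of "t / 2"] sinh_plus_cosh[of t] cosh_square_eq[of "t / 2"]
    by simp
  have 4: "1 + 2 * complex_of_real (sinh (t / 2) ^ 2) + 2 * (of_real (sinh (t / 2)) * of_real (cosh (t / 2)))
      = of_real (exp t)"
    unfolding e[symmetric] by simp
  show ?thesis
    unfolding mehler_kernel_def 1 2 3 4 using Ln_of_real[of "exp t"]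
    by (simp add: cos_of_real flip: of_real_mult)
qed

text \<open>Euler's integral that changes the lower hypergeometric parameter from \<open>1/2\<close>
  to \<open>1 - \<mu>\<close>; the exponents are written as the Beta parameters \<open>1/2\<close>
  and \<open>1/2 - \<mu>\<close> minus 1.\<close>

definition mehler_int :: "complex \<Rightarrow> real \<Rightarrow> complex \<Rightarrow> complex" where
  "mehler_int \<mu> m w = (LINT v:{0<..<1}|lborel.
     rpow v (1/2 - 1) * rpow (1 - v) (1/2 - \<mu> - 1) * mehler_kernel m (w * of_real v))"

lemma mehler_weight_integrable:
  assumes "Re \<mu> < 1/2"
  shows "set_integrable lborel {0<..<1} (\<lambda>v. rpow v (1/2 - 1) * rpow (1 - v) (1/2 - \<mu> - 1))"
  using assms by (intro Beta_integrable_lborel) auto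

lemma mehler_kernel_measurable [measurable]:
  "mehler_kernel m \<in> borel_measurable borel"
proof -
  have "csqrt \<in> borel_measurable borel"
    unfolding csqrt_conv_powr[abs_def] powr_def by measurable
  moreover have "(cos :: complex \<Rightarrow> complex) \<in> borel_measurable borel"
    by (intro borel_measurable_continuous_onI continuous_intros)
  ultimately show ?thesis unfolding mehler_kernel_def by measurable
qed

lemma mehler_int_integrable:
  assumes mu: "Re \<mu> < 1/2" and w: "Re w > 0"
  shows "set_integrable lborel {0<..<1}
    (\<lambda>v. rpow v (1/2 - 1) * rpow (1 - v) (1/2 - \<mu> - 1) * mehler_kernel m (w * of_real v))"
  unfolding set_integrable_def
proof (rule Bochner_Integration.integrable_bound)
  show "integrable lborel (\<lambda>v. exp (\<bar>m\<bar> * pi) *\<^sub>R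
         (indicator {0<..<1} v *\<^sub>R (rpow v (1/2 - 1) * rpow (1 - v) (1/2 - \<mu> - 1))))"
    using mehler_weight_integrable[OF mu] unfolding set_integrable_def
    by (rule integrable_scaleR_right)
  show "AE v in lborel. norm (indicator {0<..<1} v *\<^sub>R
       (rpow v (1/2 - 1) * rpow (1 - v) (1/2 - \<mu> - 1) * mehler_kernel m (w * of_real v)))
     \<le> norm (exp (\<bar>m\<bar> * pi) *\<^sub>R
         (indicator {0<..<1} v *\<^sub>R (rpow v (1/2 - 1) * rpow (1 - v) (1/2 - \<mu> - 1))))"
  proof (intro AE_I2)
    fix v :: real
    have "norm (mehler_kernel m (w * of_real v)) \<le> exp (\<bar>m\<bar> * pi)" if "v > 0"
      using that w by (intro norm_mehler_kernel_le) simp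
    thus "norm (indicator {0<..<1} v *\<^sub>R
       (rpow v (1/2 - 1) * rpow (1 - v) (1/2 - \<mu> - 1) * mehler_kernel m (w * of_real v)))
     \<le> norm (exp (\<bar>m\<bar> * pi) *\<^sub>R
         (indicator {0<..<1} v *\<^sub>R (rpow v (1/2 - 1) * rpow (1 - v) (1/2 - \<mu> - 1))))"
      by (auto simp: indicator_def norm_mult mult.commute[of "exp _"] intro!: mult_left_mono)
  qed
qed measurable

text \<open>The weight may be singular at the endpoints, so differentiation under the integral is
  done on compact subintervals, and the full integral is a uniform limit of holomorphic
  functions.\<close>

lemma holomorphic_mehler_int:
  assumes mu: "Re \<mu> < 1/2"
  shows "mehler_int \<mu> m holomorphic_on {w. Re w > 0}"
proof -
  define U where "U = {w. Re w > 0}"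
  have U: "open U" "convex U" unfolding U_def by (simp_all add: open_halfspace_Re_gt convex_halfspace_Re_gt)
  define q where "q = (\<lambda>v. rpow v (1/2 - 1) * rpow (1 - v) (1/2 - \<mu> - 1))"
  \<comment> \<open>The shift by 3 makes every interval nonempty and contained in
    \<open>{0<..<1}\<close>, already for \<open>n = 0\<close>.\<close>
  define I where "I = (\<lambda>n::nat. {1 / (real n + 3) .. 1 - 1 / (real n + 3)})"
  define f where "f = (\<lambda>n w. integral (I n) (\<lambda>v. q v * mehler_kernel m (w * of_real v)))"
  have I01: "I n \<subseteq> {0<..<1}" for n
  proof
    fix x assume x: "x \<in> I n"
    have "0 < 1 / (real n + 3)" by simp
    with x show "x \<in> {0<..<1}" unfolding I_def atLeastAtMost_iff greaterThanLessThan_iff by linarith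
  qed
  have [measurable]: "I n \<in> sets borel" for n unfolding I_def by measurable
  have [measurable]: "q \<in> borel_measurable borel" unfolding q_def by measurable
  have iq: "set_integrable lborel {0<..<1} q"
    using mehler_weight_integrable[OF mu] by (simp add: q_def)
  have int_all: "set_integrable lborel {0<..<1} (\<lambda>v. q v * mehler_kernel m (w * of_real v))" if "w \<in> U" for w
    using mehler_int_integrable[OF mu, of w m] that by (simp add: q_def U_def)
  have scale: "w * of_real v \<in> U" if "w \<in> U" "v \<in> I n" for w v n
    using that I01[of n] by (auto simp: U_def intro!: mult_pos_pos)
  have contq: "continuous_on (I n) q" for n
    unfolding q_def using I01[of n] by (intro continuous_intros) auto
  have holK: "mehler_kernel m holomorphic_on U"
    unfolding U_def by (rule holomorphic_mehler_kernel)
  have derK: "(mehler_kernel m has_field_derivative deriv (mehler_kernel m) w) (at w)" if "w \<in> U" for w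
    using holomorphic_derivI[OF holK U(1) that] .
  have f_hol: "f n holomorphic_on U" for n
    unfolding f_def I_def box_real(2)[symmetric]
  proof (rule leibniz_rule_holomorphic[where fx = "\<lambda>w v. q v * (deriv (mehler_kernel m) (w * of_real v) * of_real v)"])
    fix w v assume w: "w \<in> U" and "v \<in> cbox (1 / (real n + 3)) (1 - 1 / (real n + 3))"
    hence v: "v \<in> I n" by (simp add: I_def)
    show "((\<lambda>w. q v * mehler_kernel m (w * of_real v)) has_field_derivative
        q v * (deriv (mehler_kernel m) (w * of_real v) * of_real v)) (at w within U)"
      by (intro DERIV_cmult DERIV_chain2[where f = "mehler_kernel m" and g = "\<lambda>w. w * of_real v", OF derK[OF scale[OF w v]]])
         (auto intro!: derivative_eq_intros)
  next
    fix w assume w: "w \<in> U"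
    have "continuous_on (I n) (\<lambda>v. mehler_kernel m (w * of_real v))"
      by (rule continuous_on_compose2[OF holomorphic_on_imp_continuous_on[OF holK]])
         (auto intro!: continuous_intros scale w)
    hence "continuous_on (I n) (\<lambda>v. q v * mehler_kernel m (w * of_real v))"
      by (intro continuous_on_mult contq)
    thus "(\<lambda>v. q v * mehler_kernel m (w * of_real v)) integrable_on cbox (1 / (real n + 3)) (1 - 1 / (real n + 3))"
      by (intro integrable_continuous) (simp add: I_def)
  next
    have "continuous_on (U \<times> I n) (\<lambda>x. q (snd x) * (deriv (mehler_kernel m) (fst x * of_real (snd x)) * of_real (snd x)))"
      by (intro continuous_on_mult continuous_on_compose2[OF contq]
           continuous_on_compose2[OF holomorphic_on_imp_continuous_on[OF holomorphic_deriv[OF holK U(1)]]]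
           continuous_intros) (auto intro!: scale)
    thus "continuous_on (U \<times> cbox (1 / (real n + 3)) (1 - 1 / (real n + 3)))
       (\<lambda>(w, v). q v * (deriv (mehler_kernel m) (w * of_real v) * of_real v))"
      by (simp add: I_def case_prod_unfold)
  qed (rule U)
  \<comment> \<open>Mass of the weight outside the truncation; times the uniform bound of the kernel
    it controls the error for all \<open>w\<close> in the half plane at once.\<close>
  define K where "K = (\<lambda>n. LINT v|lborel. indicator ({0<..<1} - I n) v *\<^sub>R norm (q v))"
  have intK: "integrable lborel (\<lambda>v. indicator A v *\<^sub>R norm (q v))" if "A \<subseteq> {0<..<1}" "A \<in> sets borel" for A
  proof -
    have "set_integrable lborel A q" using iq by (rule set_integrable_subset) (use that in auto)
    from set_integrable_norm[OF this] show ?thesis by (simp add: set_integrable_def)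
  qed
  have K_lim: "K \<longlonglongrightarrow> (LINT v|(lborel::real measure). 0)"
    unfolding K_def
  proof (rule integral_dominated_convergence)
    show "integrable lborel (\<lambda>v. indicator {0<..<1} v *\<^sub>R norm (q v))" by (rule intK) auto
    show "AE v in lborel. (\<lambda>n. indicator ({0<..<1} - I n) v *\<^sub>R norm (q v)) \<longlonglongrightarrow> 0"
    proof (intro AE_I2)
      fix v :: real
      show "(\<lambda>n. indicator ({0<..<1} - I n) v *\<^sub>R norm (q v)) \<longlonglongrightarrow> 0"
      proof (cases "v \<in> {0<..<1}")
        case True
        have lim: "(\<lambda>n. 1 / (real n + 3)) \<longlonglongrightarrow> 0"
          using LIMSEQ_ignore_initial_segment[OF lim_1_over_n, of 3] by simp
        have "eventually (\<lambda>n. 1 / (real n + 3) < v) sequentially"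
             "eventually (\<lambda>n. 1 / (real n + 3) < 1 - v) sequentially"
          using True by (intro order_tendstoD(2)[OF lim]; simp)+
        hence "eventually (\<lambda>n. indicator ({0<..<1} - I n) v *\<^sub>R norm (q v) = 0) sequentially"
          by eventually_elim (auto simp: I_def indicator_def)
        thus ?thesis by (rule tendsto_eventually)
      qed auto
    qed
  qed (auto simp: indicator_def)
  have K_bound: "norm (f n w - mehler_int \<mu> m w) \<le> exp (\<bar>m\<bar> * pi) * K n" if w: "w \<in> U" for n w
  proof -
    define g where "g = (\<lambda>v. q v * mehler_kernel m (w * of_real v))"
    have ig: "set_integrable lborel {0<..<1} g" using int_all[OF w] by (simp add: g_def)
    have igI: "set_integrable lborel (I n) g" "set_integrable lborel ({0<..<1} - I n) g"
      by (rule set_integrable_subset[OF ig]; use I01[of n] in auto)+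
    have "f n w = (LINT v:I n|lborel. g v)"
      using set_borel_integral_eq_integral(2)[OF igI(1)] by (simp add: f_def g_def)
    moreover have "mehler_int \<mu> m w = (LINT v:(I n \<union> ({0<..<1} - I n))|lborel. g v)"
      using I01[of n] by (simp add: mehler_int_def g_def q_def Un_absorb1)
    moreover have "\<dots> = (LINT v:I n|lborel. g v) + (LINT v:({0<..<1} - I n)|lborel. g v)"
      by (rule set_integral_Un) (use igI in auto)
    ultimately have "norm (f n w - mehler_int \<mu> m w) = norm (LINT v:({0<..<1} - I n)|lborel. g v)"
      by simp
    also have "\<dots> \<le> (LINT v|lborel. exp (\<bar>m\<bar> * pi) * (indicator ({0<..<1} - I n) v *\<^sub>R norm (q v)))"
      unfolding set_lebesgue_integral_def
    proof (rule Bochner_Integration.integral_norm_bound_integral)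
      show "integrable lborel (\<lambda>v. indicat_real ({0<..<1} - I n) v *\<^sub>R g v)"
        using igI(2) by (simp add: set_integrable_def)
      show "integrable lborel (\<lambda>v. exp (\<bar>m\<bar> * pi) * (indicator ({0<..<1} - I n) v *\<^sub>R norm (q v)))"
        by (intro integrable_mult_right intK) auto
      fix v :: real
      have "norm (mehler_kernel m (w * of_real v)) \<le> exp (\<bar>m\<bar> * pi)" if "v > 0"
        using that w by (intro norm_mehler_kernel_le) (simp add: U_def)
      thus "norm (indicat_real ({0<..<1} - I n) v *\<^sub>R g v) \<le>
          exp (\<bar>m\<bar> * pi) * (indicator ({0<..<1} - I n) v *\<^sub>R norm (q v))"
        by (auto simp: indicator_def g_def norm_mult mult.commute[of "exp _"] intro!: mult_left_mono)
    qed
    also have "\<dots> = exp (\<bar>m\<bar> * pi) * K n" unfolding K_def by simp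
    finally show ?thesis .
  qed
  have "(\<lambda>n. exp (\<bar>m\<bar> * pi) * K n) \<longlonglongrightarrow> exp (\<bar>m\<bar> * pi) * 0"
    using K_lim by (intro tendsto_mult tendsto_const) simp
  hence lim: "(\<lambda>n. exp (\<bar>m\<bar> * pi) * K n) \<longlonglongrightarrow> 0" by simp
  have unif: "uniform_limit U f (mehler_int \<mu> m) sequentially"
  proof (rule uniform_limitI)
    fix e :: real assume "e > 0"
    from order_tendstoD(2)[OF lim this]
    show "\<forall>\<^sub>F n in sequentially. \<forall>w\<in>U. dist (f n w) (mehler_int \<mu> m w) < e"
    proof eventually_elim
      case (elim n)
      thus ?case using K_bound[of _ n] by (auto simp: dist_norm intro: le_less_trans)
    qed
  qed
  have "mehler_int \<mu> m holomorphic_on U"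
  proof (rule holomorphic_uniform_sequence[OF U(1) f_hol])
    fix w assume "w \<in> U"
    with U(1) obtain d where "d > 0" "cball w d \<subseteq> U" using open_contains_cball by blast
    with uniform_limit_on_subset[OF unif, of "cball w d"]
    show "\<exists>d>0. cball w d \<subseteq> U \<and> uniform_limit (cball w d) f (mehler_int \<mu> m) sequentially"
      by blast
  qed
  thus ?thesis by (simp add: U_def)
qed

lemma rpow_of_nat: "x > 0 \<Longrightarrow> rpow x (of_nat k) = of_real x ^ k"
  unfolding rpow_def exp_of_nat_mult by (simp add: exp_of_real)

lemma Beta_add_of_nat:
  fixes a b :: complex
  assumes "a \<notin> \<int>\<^sub>\<le>\<^sub>0" "a + b \<notin> \<int>\<^sub>\<le>\<^sub>0"
  shows "Beta (a + of_nat k) b = Beta a b * pochhammer a k / pochhammer (a + b) k"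
proof -
  have "Gamma a \<noteq> 0" "Gamma (a + b) \<noteq> 0" using assms by (auto simp: Gamma_eq_zero_iff)
  thus ?thesis using assms by (simp add: Beta_def pochhammer_Gamma add_ac)
qed

text \<open>Parametrised by \<open>t = 2 arsinh (sqrt y)\<close>, both sides are already known to
  equal \<open>cos (m * t) / cosh (t / 2)\<close>.\<close>

lemma mehler_kernel_eq_hyp2F1:
  assumes m: "m \<noteq> 0" and y: "0 < y" "y < 1"
  shows "mehler_kernel m (of_real y) = hyp2F1 (1/2 - \<i> * m) (1/2 + \<i> * m) (1/2) (- of_real y)"
proof -
  define t where "t = 2 * arsinh (sqrt y)"
  have s: "sinh (t / 2) = sqrt y" by (simp add: t_def)
  have "sinh (t / 2) \<ge> 0" using y by (simp add: s)
  hence "t \<ge> 0" by simp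
  moreover have "sinh (t / 2) < 1" using y by (simp add: s)
  moreover have "sinh (t / 2) ^ 2 = y" using y by (simp add: s)
  ultimately show ?thesis
    using mehler_kernel_of_real[of t m] cos_eq_hyp2F1[OF m, of t] by simp
qed

text \<open>Termwise integration of the power series gives Beta integrals with first parameter
  \<open>1/2 + k\<close>; the quotient \<open>(1/2)_k / (1 - \<mu>)_k\<close> that they produce
  exchanges the lower parameter. For \<open>0 < v < 1\<close> the series at \<open>y * v\<close> is
  dominated by the one at \<open>y\<close>, which justifies the exchange of sum and
  integral.\<close>

lemma mehler_int_eq_hyp2F1_real:
  assumes m: "m \<noteq> 0" and mu: "Re \<mu> < 1/2" and y: "0 < y" "y < 1"
  shows "mehler_int \<mu> m (of_real y) =
    Beta (1/2) (1/2 - \<mu>) * hyp2F1 (1/2 - \<i> * m) (1/2 + \<i> * m) (1 - \<mu>) (- of_real y)"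
proof -
  define q where "q = (\<lambda>v. indicator {0<..<1} v *\<^sub>R (rpow v (1/2 - 1) * rpow (1 - v) (1/2 - \<mu> - 1)))"
  define h where "h = hypcoeff (1/2 - \<i> * m) (1/2 + \<i> * m) (1/2)"
  define f where "f = (\<lambda>k v. q v * (h k * (- of_real (y * v)) ^ k))"
  have half: "(1/2 :: complex) \<notin> \<int>\<^sub>\<le>\<^sub>0" using half_not_nonpos_Int(1)[of 0] by simp
  have mu1: "1 - \<mu> \<notin> \<int>\<^sub>\<le>\<^sub>0" using mu by (auto elim!: nonpos_Ints_cases simp: complex_eq_iff)
  have [measurable]: "q \<in> borel_measurable borel" unfolding q_def by measurable
  have iq: "integrable lborel q"
    using mehler_weight_integrable[OF mu] by (simp add: q_def set_integrable_def)
  have sumh: "summable (\<lambda>k. norm (h k * z ^ k))" if "norm z < 1" for z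
    unfolding h_def by (rule summable_hypcoeff[OF half_not_nonpos_Int(2,1) half that])
  have nf: "norm (f k v) \<le> norm (h k * of_real y ^ k) * norm (q v)" for k v
  proof (cases "v \<in> {0<..<1}")
    case True
    hence "\<bar>v\<bar> ^ k \<le> 1" by (intro power_le_one) auto
    hence "norm (h k) * \<bar>y\<bar> ^ k * (\<bar>v\<bar> ^ k) \<le> norm (h k) * \<bar>y\<bar> ^ k * 1"
      by (intro mult_left_mono) auto
    hence "norm (q v) * (norm (h k) * \<bar>y\<bar> ^ k * (\<bar>v\<bar> ^ k)) \<le> norm (q v) * (norm (h k) * \<bar>y\<bar> ^ k * 1)"
      by (rule mult_left_mono) simp
    thus ?thesis by (simp add: f_def norm_mult norm_power power_mult_distrib abs_mult mult_ac)
  qed (simp add: f_def q_def)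
  have intf: "integrable lborel (f k)" for k
  proof (rule Bochner_Integration.integrable_bound)
    show "integrable lborel (\<lambda>v. norm (h k * of_real y ^ k) * norm (q v))"
      using iq by simp
    show "AE v in lborel. norm (f k v) \<le> norm (norm (h k * of_real y ^ k) * norm (q v))"
      using nf by (intro AE_I2) (simp add: abs_mult)
  qed (simp add: f_def)
  have "(\<lambda>k. integral\<^sup>L lborel (f k)) sums (LINT v|lborel. (\<Sum>k. f k v))"
  proof (rule sums_integral[OF intf])
    show "AE v in lborel. summable (\<lambda>k. norm (f k v))"
    proof (intro AE_I2)
      fix v show "summable (\<lambda>k. norm (f k v))"
      proof (rule summable_comparison_test'[of "\<lambda>k. norm (h k * of_real y ^ k) * norm (q v)" 0])
        show "summable (\<lambda>k. norm (h k * of_real y ^ k) * norm (q v))"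
          using y by (intro summable_mult2 sumh) auto
        show "norm (norm (f k v)) \<le> norm (h k * of_real y ^ k) * norm (q v)" for k
          using nf[of k v] by simp
      qed
    qed
    show "summable (\<lambda>k. LINT v|lborel. norm (f k v))"
    proof (rule summable_comparison_test'[of "\<lambda>k. norm (h k * of_real y ^ k) * (LINT v|lborel. norm (q v))" 0])
      show "summable (\<lambda>k. norm (h k * of_real y ^ k) * (LINT v|lborel. norm (q v)))"
        using y by (intro summable_mult2 sumh) auto
      fix k
      have "(LINT v|lborel. norm (f k v)) \<le> (LINT v|lborel. norm (h k * of_real y ^ k) * norm (q v))"
        using iq nf by (intro integral_mono integrable_norm integrable_mult_right intf)
      also have "\<dots> = norm (h k * of_real y ^ k) * (LINT v|lborel. norm (q v))"
        by (rule integral_mult_right_zero)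
      finally show "norm (LINT v|lborel. norm (f k v)) \<le> norm (h k * of_real y ^ k) * (LINT v|lborel. norm (q v))"
        by simp
    qed
  qed
  also have "(LINT v|lborel. (\<Sum>k. f k v)) = mehler_int \<mu> m (of_real y)"
    unfolding mehler_int_def set_lebesgue_integral_def
  proof (rule Bochner_Integration.integral_cong[OF refl])
    fix v :: real
    show "(\<Sum>k. f k v) = indicator {0<..<1} v *\<^sub>R
      (rpow v (1/2 - 1) * rpow (1 - v) (1/2 - \<mu> - 1) * mehler_kernel m (of_real y * of_real v))"
    proof (cases "v \<in> {0<..<1}")
      case True
      hence yv: "0 < y * v" "y * v < 1" using y mult_strict_mono[of y 1 v 1] by auto
      have "norm (- complex_of_real (y * v)) < 1" using yv by (simp del: of_real_mult)
      hence "(\<Sum>k. f k v) = q v * (\<Sum>k. h k * (- of_real (y * v)) ^ k)"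
        unfolding f_def by (intro suminf_mult summable_norm_cancel[OF sumh])
      also have "(\<Sum>k. h k * (- of_real (y * v)) ^ k) = mehler_kernel m (of_real (y * v))"
        by (simp only: mehler_kernel_eq_hyp2F1[OF m yv] hyp2F1_altdef h_def)
      finally show ?thesis using True by (simp add: q_def)
    qed (simp add: f_def q_def)
  qed
  also have "(\<lambda>k. integral\<^sup>L lborel (f k)) = (\<lambda>k. Beta (1/2) (1/2 - \<mu>) *
      (hypcoeff (1/2 - \<i> * m) (1/2 + \<i> * m) (1 - \<mu>) k * (- of_real y) ^ k))"
  proof
    fix k
    have "f k = (\<lambda>v. (h k * (- of_real y) ^ k) * (indicator {0<..<1} v *\<^sub>R
        (rpow v (1/2 + of_nat k - 1) * rpow (1 - v) (1/2 - \<mu> - 1))))"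
    proof
      fix v :: real
      have "rpow v (1/2 + of_nat k - 1) = rpow v (1/2 - 1) * of_real v ^ k" if "v > 0"
        using that rpow_add[of v "1/2 - 1" "of_nat k"] by (simp add: rpow_of_nat)
      moreover have "(- complex_of_real (y * v)) ^ k = (- of_real y) ^ k * of_real v ^ k"
        by (simp flip: power_mult_distrib)
      ultimately show "f k v = (h k * (- of_real y) ^ k) * (indicator {0<..<1} v *\<^sub>R
        (rpow v (1/2 + of_nat k - 1) * rpow (1 - v) (1/2 - \<mu> - 1)))"
        by (simp add: f_def q_def indicator_def)
    qed
    hence "integral\<^sup>L lborel (f k) = (h k * (- of_real y) ^ k) *
        (LINT v:{0<..<1}|lborel. rpow v (1/2 + of_nat k - 1) * rpow (1 - v) (1/2 - \<mu> - 1))"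
      by (simp only: set_lebesgue_integral_def integral_mult_right_zero)
    also have "(LINT v:{0<..<1}|lborel. rpow v (1/2 + of_nat k - 1) * rpow (1 - v) (1/2 - \<mu> - 1)) =
        Beta (1/2 + of_nat k) (1/2 - \<mu>)"
      by (rule Beta_integral_lborel) (use mu in \<open>auto simp: add_pos_nonneg\<close>)
    also have "\<dots> = Beta (1/2) (1/2 - \<mu>) * pochhammer (1/2) k / pochhammer (1 - \<mu>) k"
      using Beta_add_of_nat[OF half, of "1/2 - \<mu>" k] mu1 by simp
    also have "h k * (- of_real y) ^ k * \<dots> = Beta (1/2) (1/2 - \<mu>) *
      (hypcoeff (1/2 - \<i> * m) (1/2 + \<i> * m) (1 - \<mu>) k * (- of_real y) ^ k)"
    proof -
      have "pochhammer (1/2 :: complex) k \<noteq> 0"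
        using half pochhammer_eq_0_imp_nonpos_Int by blast
      thus ?thesis by (simp add: h_def hypcoeff_def mult_ac)
    qed
    finally show "integral\<^sup>L lborel (f k) = Beta (1/2) (1/2 - \<mu>) *
      (hypcoeff (1/2 - \<i> * m) (1/2 + \<i> * m) (1 - \<mu>) k * (- of_real y) ^ k)" .
  qed
  finally have "mehler_int \<mu> m (of_real y) = (\<Sum>k. Beta (1/2) (1/2 - \<mu>) *
      (hypcoeff (1/2 - \<i> * m) (1/2 + \<i> * m) (1 - \<mu>) k * (- of_real y) ^ k))"
    by (simp add: sums_iff)
  also have "\<dots> = Beta (1/2) (1/2 - \<mu>) * (\<Sum>k. hypcoeff (1/2 - \<i> * m) (1/2 + \<i> * m) (1 - \<mu>) k * (- of_real y) ^ k)"
    using y by (intro suminf_mult summable_norm_cancel[OF summable_hypcoeff[OF half_not_nonpos_Int(2,1) mu1]]) auto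
  finally show ?thesis by (simp add: hyp2F1_altdef)
qed

section \<open>Identity theorem and the continuation of the Legendre function\<close>

lemma of_real_islimpt:
  assumes "a < x" "x < (b::real)"
  shows "complex_of_real x islimpt of_real ` {a<..<b}"
  unfolding islimpt_approachable
proof (intro allI impI)
  fix e :: real assume "e > 0"
  define d where "d = min (e / 2) ((b - x) / 2)"
  have d: "0 < d" "d < e" "d < b - x" using \<open>e > 0\<close> assms by (auto simp: d_def min_def)
  have "complex_of_real (x + d) \<in> of_real ` {a<..<b}" using d assms by (intro imageI) auto
  moreover have "complex_of_real (x + d) \<noteq> of_real x" using d by (simp only: of_real_eq_iff)
  moreover have "dist (complex_of_real (x + d)) (of_real x) < e" using d by (simp add: dist_norm)
  ultimately show "\<exists>x'\<in>of_real ` {a<..<b}. x' \<noteq> complex_of_real x \<and> dist x' (of_real x) < e" by blast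
qed

lemma holomorphic_hyp2F1:
  assumes "a \<notin> \<int>\<^sub>\<le>\<^sub>0" "b \<notin> \<int>\<^sub>\<le>\<^sub>0" "c \<notin> \<int>\<^sub>\<le>\<^sub>0"
  shows "hyp2F1 a b c holomorphic_on ball 0 1"
proof -
  obtain F1 F2 where "\<forall>z. norm z < 1 \<longrightarrow>
     (hyp2F1 a b c has_field_derivative F1 z) (at z) \<and> (F1 has_field_derivative F2 z) (at z) \<and>
     z * (1 - z) * F2 z + (c - (a + b + 1) * z) * F1 z - a * b * hyp2F1 a b c z = 0"
    using hyp2F1_ode[OF assms] by (elim exE) (rule that)
  thus ?thesis by (auto simp: holomorphic_on_open)
qed

text \<open>The segment \<open>0 < y < 1\<close>, where the identity is known, has limit points
  inside the half disc, on which both sides are holomorphic.\<close>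

lemma mehler_int_eq_hyp2F1:
  assumes m: "m \<noteq> 0" and mu: "Re \<mu> < 1/2" and w: "Re w > 0" "norm w < 1"
  shows "mehler_int \<mu> m w =
    Beta (1/2) (1/2 - \<mu>) * hyp2F1 (1/2 - \<i> * m) (1/2 + \<i> * m) (1 - \<mu>) (- w)"
proof -
  define U where "U = {w. Re w > 0} \<inter> ball 0 1"
  have U: "open U" "connected U"
    unfolding U_def by (auto intro!: open_Int open_halfspace_Re_gt convex_connected convex_Int convex_halfspace_Re_gt)
  have mu1: "1 - \<mu> \<notin> \<int>\<^sub>\<le>\<^sub>0" using mu by (auto elim!: nonpos_Ints_cases simp: complex_eq_iff)
  let ?H = "hyp2F1 (1/2 - \<i> * m) (1/2 + \<i> * m) (1 - \<mu>)"
  have "?H holomorphic_on ball 0 1"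
    by (rule holomorphic_hyp2F1[OF half_not_nonpos_Int(2,1) mu1])
  hence "(?H \<circ> uminus) holomorphic_on U"
    by (intro holomorphic_on_compose_gen[of _ _ _ "ball 0 1"]) (auto intro!: holomorphic_intros simp: U_def)
  hence hol: "(\<lambda>w. mehler_int \<mu> m w - Beta (1/2) (1/2 - \<mu>) * ?H (- w)) holomorphic_on U"
    using holomorphic_on_subset[OF holomorphic_mehler_int[OF mu, of m], of U]
    by (intro holomorphic_intros) (auto simp: o_def U_def)
  have "mehler_int \<mu> m w - Beta (1/2) (1/2 - \<mu>) * ?H (- w) = 0"
  proof (rule analytic_continuation[OF hol U])
    show "complex_of_real ` {0<..<1} \<subseteq> U" by (auto simp: U_def)
    show "complex_of_real (1/2) islimpt of_real ` {0<..<1}" by (rule of_real_islimpt) auto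
    show "mehler_int \<mu> m z - Beta (1/2) (1/2 - \<mu>) * ?H (- z) = 0" if "z \<in> of_real ` {0<..<1}" for z
      using that mehler_int_eq_hyp2F1_real[OF m mu] by auto
  qed (use w in \<open>auto simp: U_def\<close>)
  thus ?thesis by simp
qed

text \<open>The choice in \<open>LegP\<close> is unique: two continuations agree with the same local
  function on the segment from 1 to 3 and hence along the ray. Any one continuation therefore
  computes it.\<close>

lemma LegP_eqI:
  assumes S0: "open S0" "complex_of_real ` {1<..} \<subseteq> S0" "connected S0"
    and G0: "G0 holomorphic_on S0" "\<And>z. z \<in> S0 \<inter> ball 1 2 \<Longrightarrow> G0 z = LegP_near \<mu> \<nu> z"
    and x: "x > 1"
  shows "LegP \<mu> \<nu> x = G0 (of_real x)"
  unfolding LegP_def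
proof (rule some_equality)
  show "\<exists>S G. open S \<and> connected S \<and> complex_of_real ` {1<..} \<subseteq> S \<and> G holomorphic_on S \<and>
     (\<forall>z\<in>S \<inter> ball 1 2. G z = LegP_near \<mu> \<nu> z) \<and> G0 (of_real x) = G (of_real x)"
    using S0 G0 by blast
next
  fix v assume "\<exists>S G. open S \<and> connected S \<and> complex_of_real ` {1<..} \<subseteq> S \<and> G holomorphic_on S \<and>
     (\<forall>z\<in>S \<inter> ball 1 2. G z = LegP_near \<mu> \<nu> z) \<and> v = G (of_real x)"
  then obtain S G where S: "open S" "complex_of_real ` {1<..} \<subseteq> S" and G: "G holomorphic_on S"
    "\<And>z. z \<in> S \<inter> ball 1 2 \<Longrightarrow> G z = LegP_near \<mu> \<nu> z" and v: "v = G (of_real x)" by blast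
  \<comment> \<open>\<open>S \<inter> S0\<close> need not be connected. The component of 2 contains
    the connected ray, and the identity theorem is applied there.\<close>
  define C where "C = connected_component_set (S \<inter> S0) 2"
  have C: "open C" "connected C" "C \<subseteq> S \<inter> S0"
    unfolding C_def using S(1) S0(1)
    by (auto intro!: open_connected_component intro: connected_connected_component dest: connected_component_in)
  have ray: "complex_of_real ` {1<..} \<subseteq> C" unfolding C_def
  proof (rule connected_component_maximal)
    show "2 \<in> complex_of_real ` {1<..}" by (rule image_eqI[of _ _ 2]) auto
    show "connected (complex_of_real ` {1<..})"
      by (intro connected_continuous_image continuous_intros convex_connected) auto
  qed (use S S0 in auto)
  have "G (of_real x) - G0 (of_real x) = 0"
  proof (rule analytic_continuation[of "\<lambda>z. G z - G0 z" C])
    show "(\<lambda>z. G z - G0 z) holomorphic_on C"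
      using C(3) by (intro holomorphic_on_diff holomorphic_on_subset[OF G(1)] holomorphic_on_subset[OF G0(1)]) auto
    show "complex_of_real ` {1<..<3} \<subseteq> C" using ray by auto
    show "complex_of_real 2 islimpt of_real ` {1<..<3}" by (rule of_real_islimpt) auto
    show "complex_of_real 2 \<in> C" "of_real x \<in> C" by (rule subsetD[OF ray]; use x in \<open>intro imageI, simp\<close>)+
    fix z assume "z \<in> complex_of_real ` {1<..<3}"
    then obtain y where y: "z = of_real y" "1 < y" "y < 3" by auto
    have "1 - z = of_real (1 - y)" by (simp add: y)
    hence "dist 1 z = \<bar>1 - y\<bar>" by (simp only: dist_norm norm_of_real)
    hence "dist 1 z < 2" using y by simp
    hence "z \<in> S \<inter> ball 1 2" "z \<in> S0 \<inter> ball 1 2" using y S S0 by auto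
    thus "G z - G0 z = 0" using G(2) G0(2) by simp
  qed (use C in auto)
  thus "v = G0 (of_real x)" by (simp add: v)
qed

text \<open>On \<open>Re z > 1\<close> the quotient \<open>(z + 1) / (z - 1)\<close> has positive
  real part, so its principal power is holomorphic, and \<open>(z - 1) / 2\<close> lies in the half
  plane where \<open>mehler_int\<close> is. The constant comes from
  \<open>Gamma (1 - \<mu>) * Beta (1/2) (1/2 - \<mu>)\<close> and
  \<open>Gamma (1/2) = sqrt pi\<close>.\<close>

lemma LegP_eq_mehler_int:
  assumes m: "m \<noteq> 0" and mu: "Re \<mu> < 1/2" and x: "x > 1"
  shows "LegP \<mu> (\<i> * of_real m - 1/2) x =
    rpow ((x + 1) / (x - 1)) (\<mu> / 2) * mehler_int \<mu> m (of_real ((x - 1) / 2)) /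
      (of_real (sqrt pi) * Gamma (1/2 - \<mu>))"
proof -
  define S where "S = {z. Re z > 1}"
  define G where "G = (\<lambda>z. 1 / Gamma (1 - \<mu>) * ((z + 1) / (z - 1)) powr (\<mu> / 2) *
      (mehler_int \<mu> m ((z - 1) / 2) / Beta (1/2) (1/2 - \<mu>)))"
  have Gam: "Gamma (1 - \<mu>) \<noteq> 0" "Gamma (1/2 - \<mu>) \<noteq> 0"
    unfolding Gamma_eq_zero_iff using mu by (auto simp: complex_eq_iff elim!: nonpos_Ints_cases)
  have half: "Gamma (1/2 :: complex) = of_real (sqrt pi)" by (rule Gamma_one_half_complex)
  have B: "Beta (1/2) (1/2 - \<mu>) = of_real (sqrt pi) * Gamma (1/2 - \<mu>) / Gamma (1 - \<mu>)"
    by (simp add: Beta_def half)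
  have B0: "Beta (1/2) (1/2 - \<mu>) \<noteq> 0" using Gam by (simp add: B)
  have "LegP \<mu> (\<i> * of_real m - 1/2) x = G (of_real x)"
  proof (rule LegP_eqI[of S])
    show "open S" "connected S"
      unfolding S_def by (auto intro!: open_halfspace_Re_gt convex_connected convex_halfspace_Re_gt)
    show "complex_of_real ` {1<..} \<subseteq> S" by (auto simp: S_def)
    have hm: "(mehler_int \<mu> m \<circ> (\<lambda>z. (z - 1) / 2)) holomorphic_on S"
      by (rule holomorphic_on_compose_gen[OF _ holomorphic_mehler_int[OF mu]])
         (auto intro!: holomorphic_intros simp: S_def)
    have "(z + 1) / (z - 1) \<notin> \<real>\<^sub>\<le>\<^sub>0" "z - 1 \<noteq> 0" if "z \<in> S" for z
    proof -
      show "z - 1 \<noteq> 0" using that by (auto simp: S_def)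
      have "Re ((z + 1) / (z - 1)) = ((Re z)\<^sup>2 - 1 + (Im z)\<^sup>2) / ((Re z - 1)\<^sup>2 + (Im z)\<^sup>2)"
        by (simp add: Re_divide power2_eq_square algebra_simps)
      moreover have "(Re z)\<^sup>2 - 1 > 0" using that by (simp add: S_def one_less_power)
      moreover have "(Re z - 1)\<^sup>2 > 0" using that by (simp add: S_def)
      ultimately have "Re ((z + 1) / (z - 1)) > 0"
        by (simp only:) (intro divide_pos_pos add_pos_nonneg; simp)
      thus "(z + 1) / (z - 1) \<notin> \<real>\<^sub>\<le>\<^sub>0" by (rule not_nonpos_Real_if_Re_pos)
    qed
    thus "G holomorphic_on S"
      unfolding G_def using hm B0 by (intro holomorphic_intros) (auto simp: o_def)
    show "G z = LegP_near \<mu> (\<i> * of_real m - 1/2) z" if z: "z \<in> S \<inter> ball 1 2" for z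
    proof -
      have 1: "Re ((z - 1) / 2) > 0" "norm ((z - 1) / 2) < 1"
        using z by (auto simp: S_def dist_norm norm_minus_commute norm_divide)
      have 2: "- (\<i> * of_real m - 1/2) = 1/2 - \<i> * of_real m" "1 + (\<i> * of_real m - 1/2) = 1/2 + \<i> * of_real m"
        "- ((z - 1) / 2) = (1 - z) / 2"
        by (simp_all add: field_simps)
      show ?thesis
        unfolding G_def LegP_near_def mehler_int_eq_hyp2F1[OF m mu 1] 2 using B0 by simp
    qed
  qed (rule x)
  also have "G (of_real x) = 1 / Gamma (1 - \<mu>) * (of_real ((x + 1) / (x - 1)) powr (\<mu> / 2)) *
      (mehler_int \<mu> m (of_real ((x - 1) / 2)) / Beta (1/2) (1/2 - \<mu>))"
    by (simp add: G_def)
  also have "of_real ((x + 1) / (x - 1)) powr (\<mu> / 2) = rpow ((x + 1) / (x - 1)) (\<mu> / 2)"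
    using x by (subst rpow_eq_powr) auto
  finally show ?thesis unfolding B using Gam by simp
qed

subsection \<open>The Mehler-Dirichlet formula\<close>

text \<open>Extended by zero, so that integrals with variable limits become integrals over the whole
  line and one measurable function of \<open>t\<close> and \<open>\<theta>\<close> enters
  Fubini.\<close>

definition abel_kernel :: "complex \<Rightarrow> real \<Rightarrow> real \<Rightarrow> complex" where
  "abel_kernel \<mu> t \<theta> = (if 0 < \<theta> \<and> cosh \<theta> < t then rpow (t - cosh \<theta>) (- \<mu> - 1/2) else 0)"

text \<open>The substitution is \<open>v = sinh (\<theta> / 2)^2 / y\<close> with
  \<open>y = (t - 1) / 2\<close>, which gives \<open>1 - v = (t - cosh \<theta>) / (t - 1)\<close>.
  The case \<open>m = 0\<close> yields integrability of the kernel itself.\<close>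

lemma mehler_int_eq_abel:
  assumes mu: "Re \<mu> < 1/2" and t: "t > 1"
  shows "integrable lborel (\<lambda>\<theta>. of_real (cos (m * \<theta>)) * abel_kernel \<mu> t \<theta>)"
    and "mehler_int \<mu> m (of_real ((t - 1) / 2)) = of_real (sqrt 2) * rpow (t - 1) \<mu> *
           (LINT \<theta>|lborel. of_real (cos (m * \<theta>)) * abel_kernel \<mu> t \<theta>)"
proof -
  define y where "y = (t - 1) / 2"
  have y: "y > 0" using t by (simp add: y_def)
  define A where "A = arcosh t"
  have A: "A > 0" "cosh A = t" using t by (simp_all add: A_def)
  define S where "S = {0<..<A}"
  define g where "g = (\<lambda>\<theta>::real. sinh (\<theta> / 2) ^ 2 / y)"
  define g' where "g' = (\<lambda>\<theta>::real. sinh (\<theta> / 2) * cosh (\<theta> / 2) / y)"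
  define f where "f = (\<lambda>v. rpow v (1/2 - 1) * rpow (1 - v) (1/2 - \<mu> - 1) * mehler_kernel m (of_real y * of_real v))"
  define c where "c = of_real (sqrt 2) * rpow (t - 1) \<mu>"
  define k where "k = (\<lambda>\<theta>. of_real (cos (m * \<theta>)) * abel_kernel \<mu> t \<theta>)"
  have sinh_sq: "sinh (\<theta> / 2) ^ 2 = (cosh \<theta> - 1) / 2" for \<theta> :: real
    using cosh_double[of "\<theta> / 2"] cosh_square_eq[of "\<theta> / 2"] by simp
  have S_iff: "\<theta> \<in> S \<longleftrightarrow> 0 < \<theta> \<and> cosh \<theta> < t" for \<theta>
  proof (cases "0 < \<theta>")
    case True
    hence "cosh \<theta> < cosh A \<longleftrightarrow> \<theta> < A" using A by (intro cosh_real_nonneg_less_iff) auto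
    with True A show ?thesis by (simp add: S_def)
  qed (simp add: S_def)
  have g01: "1 - g \<theta> = (t - cosh \<theta>) / (t - 1)" for \<theta>
    using t by (simp add: g_def y_def sinh_sq field_simps)
  have img: "g ` S = {0<..<1}"
  proof safe
    fix \<theta> assume "\<theta> \<in> S"
    hence th: "0 < \<theta>" "cosh \<theta> < t" by (auto simp: S_iff)
    hence "1 - g \<theta> > 0" using t unfolding g01 by simp
    moreover have "g \<theta> > 0" using th y by (simp add: g_def)
    ultimately show "g \<theta> \<in> {0<..<1}" by simp
  next
    fix v :: real assume v: "v \<in> {0<..<1}"
    define \<theta> where "\<theta> = 2 * arsinh (sqrt (y * v))"
    have s: "sinh (\<theta> / 2) = sqrt (y * v)" by (simp add: \<theta>_def)
    have "sinh (\<theta> / 2) > 0" using v y by (simp add: s)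
    hence pos: "\<theta> > 0" by simp
    have gv: "g \<theta> = v" using v y by (simp add: g_def s)
    have "1 - g \<theta> > 0" using v by (simp add: gv)
    hence "cosh \<theta> < t" using t unfolding g01 by (simp add: zero_less_divide_iff)
    with pos gv show "v \<in> g ` S" by (auto simp: S_iff)
  qed
  have inj: "inj_on g S"
  proof (rule inj_onI)
    fix a b assume ab: "a \<in> S" "b \<in> S" "g a = g b"
    hence "(t - cosh a) / (t - 1) = (t - cosh b) / (t - 1)" by (simp only: g01[symmetric])
    hence "\<bar>a\<bar> = \<bar>b\<bar>" using t by simp
    thus "a = b" using ab by (simp add: S_iff)
  qed
  have der: "(g has_real_derivative g' \<theta>) (at \<theta> within S)" for \<theta>
    unfolding g_def g'_def using y
    by (auto intro!: derivative_eq_intros simp: field_simps)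
  have fg: "\<bar>g' \<theta>\<bar> *\<^sub>R f (g \<theta>) = c * k \<theta>" if "\<theta> \<in> S" for \<theta>
  proof -
    have th: "0 < \<theta>" "cosh \<theta> < t" using that by (auto simp: S_iff)
    define s where "s = sinh (\<theta> / 2)"
    have s: "s > 0" using th by (simp add: s_def)
    have ygs: "y * g \<theta> = s ^ 2" using y by (simp add: g_def s_def)
    have "of_real y * complex_of_real (g \<theta>) = of_real (sinh (\<theta> / 2) ^ 2)"
      unfolding of_real_mult[symmetric] ygs s_def ..
    hence 1: "mehler_kernel m (of_real y * of_real (g \<theta>)) = of_real (cos (m * \<theta>) / cosh (\<theta> / 2))"
      using mehler_kernel_of_real[of \<theta> m] th by simp
    have gs: "g \<theta> = (s / sqrt y) ^ 2" using y by (simp add: g_def s_def power_divide)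
    have "rpow (g \<theta>) (1/2 - 1) = rpow (g \<theta>) (of_real (- 1/2))" by simp
    also have "\<dots> = of_real (g \<theta> powr (- 1/2))"
      using s y by (intro rpow_of_real) (simp add: gs)
    also have "g \<theta> powr (- 1/2) = sqrt y / s"
      using s y unfolding gs by (simp add: powr_minus powr_half_sqrt real_sqrt_divide)
    finally have 2: "rpow (g \<theta>) (1/2 - 1) = of_real (sqrt y / s)" .
    have 3: "rpow (1 - g \<theta>) (1/2 - \<mu> - 1) = rpow (t - cosh \<theta>) (- \<mu> - 1/2) * rpow (t - 1) (\<mu> + 1/2)"
    proof -
      have e: "1/2 - \<mu> - 1 = - \<mu> - 1/2" "- \<mu> - 1/2 = - (\<mu> + 1/2)" by simp_all
      have "t - cosh \<theta> > 0" "t - 1 > 0" using th t by auto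
      hence "rpow (1 - g \<theta>) (1/2 - \<mu> - 1) = rpow (t - cosh \<theta>) (- \<mu> - 1/2) / rpow (t - 1) (- \<mu> - 1/2)"
        unfolding g01 e(1) by (rule rpow_divide)
      also have "rpow (t - 1) (- \<mu> - 1/2) = inverse (rpow (t - 1) (\<mu> + 1/2))"
        unfolding e(2) by (rule rpow_minus)
      finally show ?thesis by (simp only: divide_inverse inverse_inverse_eq)
    qed
    have 4: "rpow (t - 1) (\<mu> + 1/2) = rpow (t - 1) \<mu> * of_real (sqrt (2 * y))"
    proof -
      have "rpow (t - 1) (of_real (1/2)) = of_real ((t - 1) powr (1/2))"
        using t by (intro rpow_of_real) auto
      thus ?thesis using t unfolding rpow_add by (simp add: powr_half_sqrt y_def)
    qed
    have ab: "\<bar>g' \<theta>\<bar> = s * cosh (\<theta> / 2) / y" using s y by (simp add: g'_def s_def abs_mult)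
    \<comment> \<open>The Jacobian cancels the singular factor \<open>1 / s\<close> of the weight,
      and its \<open>cosh (\<theta> / 2)\<close> cancels the denominator of the continued kernel;
      only \<open>sqrt 2\<close> and the cosine remain.\<close>
    have real_eq: "s * cosh (\<theta> / 2) / y * (sqrt y / s) * sqrt (2 * y) * (cos (m * \<theta>) / cosh (\<theta> / 2)) =
        sqrt 2 * cos (m * \<theta>)"
    proof -
      have "sqrt y * sqrt (2 * y) = sqrt 2 * y" using y by (simp add: real_sqrt_mult)
      thus ?thesis using s y by (simp add: field_simps)
    qed
    have "\<bar>g' \<theta>\<bar> *\<^sub>R f (g \<theta>) =
      of_real (s * cosh (\<theta> / 2) / y * (sqrt y / s) * sqrt (2 * y) * (cos (m * \<theta>) / cosh (\<theta> / 2))) *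
      rpow (t - 1) \<mu> * rpow (t - cosh \<theta>) (- \<mu> - 1/2)"
      unfolding f_def 1 2 3 4 ab scaleR_conv_of_real of_real_mult by (simp only: mult_ac)
    also have "\<dots> = c * k \<theta>"
      unfolding real_eq using th by (simp add: c_def k_def abel_kernel_def)
    finally show ?thesis .
  qed
  have k0: "k \<theta> = 0" if "\<theta> \<notin> S" for \<theta> using that by (auto simp: k_def abel_kernel_def S_iff)
  have [measurable]: "k \<in> borel_measurable borel" unfolding k_def abel_kernel_def by measurable
  have meas: "set_borel_measurable lborel {0<..<1} f"
    unfolding set_borel_measurable_def f_def by measurable
  have si: "set_integrable lborel {0<..<1} f"
    using mehler_int_integrable[OF mu, of "of_real y" m] y by (simp add: f_def)
  have "f absolutely_integrable_on g ` S \<and> integral (g ` S) f = mehler_int \<mu> m (of_real y)"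
    using si set_borel_integral_eq_integral(2)[OF si] borel_set_integrable_iff[OF meas]
    unfolding img by (simp add: mehler_int_def f_def)
  hence "(\<lambda>\<theta>. \<bar>g' \<theta>\<bar> *\<^sub>R f (g \<theta>)) absolutely_integrable_on S \<and>
         integral S (\<lambda>\<theta>. \<bar>g' \<theta>\<bar> *\<^sub>R f (g \<theta>)) = mehler_int \<mu> m (of_real y)"
    by (subst has_absolute_integral_change_of_variables_real[of _ g]) (use der inj in \<open>auto simp: S_def\<close>)
  moreover have "(\<lambda>\<theta>. \<bar>g' \<theta>\<bar> *\<^sub>R f (g \<theta>)) absolutely_integrable_on S \<longleftrightarrow> (\<lambda>\<theta>. c * k \<theta>) absolutely_integrable_on S"
    by (rule set_integrable_cong) (simp_all add: fg)
  moreover have "integral S (\<lambda>\<theta>. \<bar>g' \<theta>\<bar> *\<^sub>R f (g \<theta>)) = integral S (\<lambda>\<theta>. c * k \<theta>)"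
    by (rule Henstock_Kurzweil_Integration.integral_cong) (rule fg)
  ultimately have ck: "(\<lambda>\<theta>. c * k \<theta>) absolutely_integrable_on S" "integral S (\<lambda>\<theta>. c * k \<theta>) = mehler_int \<mu> m (of_real y)"
    by simp_all
  have meas2: "set_borel_measurable lborel S (\<lambda>\<theta>. c * k \<theta>)"
    unfolding set_borel_measurable_def S_def by measurable
  have si2: "set_integrable lborel S (\<lambda>\<theta>. c * k \<theta>)"
    using ck(1) borel_set_integrable_iff[OF meas2] by simp
  have ind: "indicator S \<theta> *\<^sub>R (c * k \<theta>) = c * k \<theta>" for \<theta>
    using k0[of \<theta>] by (auto simp: indicator_def)
  have c0: "c \<noteq> 0" by (simp add: c_def)
  have ick: "integrable lborel (\<lambda>\<theta>. c * k \<theta>)" and int: "(LINT \<theta>|lborel. c * k \<theta>) = mehler_int \<mu> m (of_real y)"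
    using si2 set_borel_integral_eq_integral(2)[OF si2] ck(2)
    unfolding set_integrable_def set_lebesgue_integral_def ind by (simp_all only:)
  have "integrable lborel (\<lambda>\<theta>. inverse c * (c * k \<theta>))" by (rule integrable_mult_right[OF ick])
  thus "integrable lborel (\<lambda>\<theta>. of_real (cos (m * \<theta>)) * abel_kernel \<mu> t \<theta>)"
    by (simp only: k_def[symmetric] mult.assoc[symmetric] left_inverse[OF c0] mult_1_left)
  show "mehler_int \<mu> m (of_real ((t - 1) / 2)) = of_real (sqrt 2) * rpow (t - 1) \<mu> *
           (LINT \<theta>|lborel. of_real (cos (m * \<theta>)) * abel_kernel \<mu> t \<theta>)"
    using int by (simp add: y_def[symmetric] c_def[symmetric] k_def[symmetric])
qed

lemma abel_kernel_integrable:
  assumes "Re \<mu> < 1/2" "t > 1"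
  shows "integrable lborel (abel_kernel \<mu> t)"
  using mehler_int_eq_abel(1)[OF assms, of 0] by simp

text \<open>The powers \<open>((t + 1) / (t - 1))^(\<mu>/2)\<close> and \<open>(t - 1)^\<mu>\<close>
  collect into \<open>(t^2 - 1)^(\<mu>/2)\<close>.\<close>

lemma LegP_mehler_dirichlet:
  assumes m: "m \<noteq> 0" and mu: "Re \<mu> < 1/2" and t: "t > 1"
  shows "LegP \<mu> (\<i> * of_real m - 1/2) t =
    of_real (sqrt (2 / pi)) / Gamma (1/2 - \<mu>) * rpow (t\<^sup>2 - 1) (\<mu> / 2) *
      (LINT \<theta>|lborel. of_real (cos (m * \<theta>)) * abel_kernel \<mu> t \<theta>)"
proof -
  have "t\<^sup>2 - 1 = (t + 1) * (t - 1)" by (simp add: power2_eq_square algebra_simps)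
  hence 1: "rpow (t\<^sup>2 - 1) (\<mu> / 2) = rpow (t + 1) (\<mu> / 2) * rpow (t - 1) (\<mu> / 2)"
    using t by (simp add: rpow_mult)
  have 2: "rpow (t - 1) \<mu> = rpow (t - 1) (\<mu> / 2) * rpow (t - 1) (\<mu> / 2)"
    by (simp flip: rpow_add)
  have 3: "rpow ((t + 1) / (t - 1)) (\<mu> / 2) = rpow (t + 1) (\<mu> / 2) / rpow (t - 1) (\<mu> / 2)"
    using t by (simp add: rpow_divide)
  show ?thesis
    unfolding LegP_eq_mehler_int[OF m mu t] mehler_int_eq_abel(2)[OF mu t] 1 2 3
    by (simp add: real_sqrt_divide)
qed

subsection \<open>An elementary Stieltjes integral\<close>

lemma stieltjes_ratio_tendsto:
  fixes p q :: real
  assumes "p + q > 0"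
  shows "((\<lambda>t. (t - p) / (t + q)) \<longlongrightarrow> 0) (at_right p)"
    and "((\<lambda>t. (t - p) / (t + q)) \<longlongrightarrow> 1) at_top"
proof -
  have "((\<lambda>t. (t - p) / (t + q)) \<longlongrightarrow> (p - p) / (p + q)) (at_right p)"
    using assms by (intro tendsto_intros) auto
  thus "((\<lambda>t. (t - p) / (t + q)) \<longlongrightarrow> 0) (at_right p)" by simp
  have inf: "filterlim (\<lambda>t. t + q) at_infinity at_top"
    by (rule filterlim_at_top_imp_at_infinity)
       (simp add: filterlim_ident filterlim_at_top_add_at_top filterlim_tendsto_add_at_top[OF tendsto_const] add.commute[of _ q])
  have "((\<lambda>t. 1 - (p + q) / (t + q)) \<longlongrightarrow> 1 - 0) at_top"
    by (intro tendsto_diff tendsto_const tendsto_divide_0[OF tendsto_const inf])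
  moreover have "eventually (\<lambda>t. 1 - (p + q) / (t + q) = (t - p) / (t + q)) at_top"
    using eventually_gt_at_top[of "- q"] by eventually_elim (simp add: field_simps)
  ultimately show "((\<lambda>t. (t - p) / (t + q)) \<longlongrightarrow> 1) at_top"
    by (simp add: filterlim_cong)
qed

lemma stieltjes_ratio_derivative:
  fixes p q t :: real
  assumes "p + q > 0" "t > p"
  shows "((\<lambda>t. (t - p) / (t + q)) has_real_derivative (p + q) / (t + q)\<^sup>2) (at t)"
  using assms by (auto intro!: derivative_eq_intros simp: power2_eq_square field_simps)

text \<open>The ratio \<open>(t - p) / (t + q)\<close> runs from 0 to 1 with derivative
  \<open>(p + q) / (t + q)^2\<close>, so the integrand is, up to a constant, the derivative of its
  \<open>b\<close>-th power. Nonnegativity lets the fundamental theorem deliver integrability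
  together with the value.\<close>

lemma kernel_integral_real:
  fixes p q b :: real
  assumes pq: "p + q > 0" and b: "b > 0"
  shows "set_integrable lborel {p<..} (\<lambda>t. (t - p) powr (b - 1) * (t + q) powr (- b - 1))"
    and "(LINT t:{p<..}|lborel. (t - p) powr (b - 1) * (t + q) powr (- b - 1)) = 1 / (b * (p + q))"
proof -
  let ?f = "\<lambda>t. (t - p) powr (b - 1) * (t + q) powr (- b - 1)"
  let ?F = "\<lambda>t. ((t - p) / (t + q)) powr b / (b * (p + q))"
  have der: "(?F has_real_derivative ?f t) (at t)" if t: "t > p" for t
  proof -
    have pos: "t + q > 0" "t - p > 0" using t pq by auto
    have "(?F has_real_derivative (b * ((t - p) / (t + q)) powr (b - 1) * ((p + q) / (t + q)\<^sup>2)) / (b * (p + q))) (at t)"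
      using has_real_derivative_powr[of "(t - p) / (t + q)" b] pos
      by (intro DERIV_cdivide DERIV_chain2[OF _ stieltjes_ratio_derivative[OF pq t]]) auto
    also have "(b * ((t - p) / (t + q)) powr (b - 1) * ((p + q) / (t + q)\<^sup>2)) / (b * (p + q)) =
        (t - p) powr (b - 1) * ((t + q) powr - (b - 1) * (t + q) powr (- 2))"
      using b pq pos unfolding powr_minus by (simp add: powr_divide) (simp add: field_simps)
    also have "(t + q) powr - (b - 1) * (t + q) powr (- 2) = (t + q) powr (- (b - 1) + - 2)"
      by (rule powr_add[symmetric])
    also have "- (b - 1) + - 2 = - b - 1" by simp
    finally show ?thesis .
  qed
  have cont: "isCont ?f t" if "t > p" for t
    using that pq by (intro continuous_intros) auto
  have lim0: "(?F \<longlongrightarrow> 0) (at_right p)"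
  proof -
    have "((\<lambda>t. ((t - p) / (t + q)) powr b) \<longlongrightarrow> 0) (at_right p)"
      by (rule tendsto_zero_powrI[OF stieltjes_ratio_tendsto(1)[OF pq] tendsto_const _ b])
         (use pq in \<open>auto simp: eventually_at_right_less intro!: eventually_mono[OF eventually_at_right_less]\<close>)
    from tendsto_divide[OF this tendsto_const[of "b * (p + q)"]] show ?thesis using b pq by simp
  qed
  have lim1: "(?F \<longlongrightarrow> 1 / (b * (p + q))) at_top"
  proof -
    have "((\<lambda>t. ((t - p) / (t + q)) powr b) \<longlongrightarrow> 1 powr b) at_top"
      by (rule tendsto_powr[OF stieltjes_ratio_tendsto(2)[OF pq] tendsto_const]) simp
    from tendsto_divide[OF this tendsto_const[of "b * (p + q)"]] show ?thesis using b pq by simp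
  qed
  have "set_integrable lborel (einterval (ereal p) \<infinity>) ?f"
       "(LBINT t=ereal p..\<infinity>. ?f t) = 1 / (b * (p + q)) - 0"
    by (rule interval_integral_FTC_nonneg[of _ _ ?F]; use der cont lim0 lim1 in \<open>auto simp: ereal_tendsto_simps\<close>)+
  thus "set_integrable lborel {p<..} ?f" "(LINT t:{p<..}|lborel. ?f t) = 1 / (b * (p + q))"
    by (simp_all add: interval_lebesgue_integral_def)
qed

text \<open>The modulus of the integrand is the real integrand at \<open>Re b\<close>, which
  supplies integrability; the value comes from the same primitive, whose limit at \<open>p\<close>
  is zero because its modulus tends to zero for \<open>Re b > 0\<close>.\<close>

lemma kernel_integral:
  fixes p q :: real and b :: complex
  assumes pq: "p + q > 0" and b: "Re b > 0"
  shows "set_integrable lborel {p<..} (\<lambda>t. rpow (t - p) (b - 1) * rpow (t + q) (- b - 1))"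
    and "(LINT t:{p<..}|lborel. rpow (t - p) (b - 1) * rpow (t + q) (- b - 1)) = 1 / (b * of_real (p + q))"
proof -
  let ?f = "\<lambda>t. rpow (t - p) (b - 1) * rpow (t + q) (- b - 1)"
  let ?F = "\<lambda>t. rpow ((t - p) / (t + q)) b / (b * of_real (p + q))"
  show int: "set_integrable lborel {p<..} ?f"
    using kernel_integral_real(1)[OF pq b] unfolding set_integrable_def
    by (rule Bochner_Integration.integrable_bound)
       (use pq in \<open>auto simp: indicator_def norm_mult norm_rpow intro!: AE_I2\<close>)
  have b0: "b \<noteq> 0" using b by auto
  have der: "(?F has_vector_derivative ?f t) (at t)" if t: "t > p" for t
  proof -
    have pos: "t + q > 0" "t - p > 0" using t pq by auto
    have "(?F has_vector_derivative (b * rpow ((t - p) / (t + q)) (b - 1) * of_real ((p + q) / (t + q)\<^sup>2)) / (b * of_real (p + q))) (at t)"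
      by (intro has_vector_derivative_divide has_vector_derivative_rpow stieltjes_ratio_derivative pq t)
         (use pos in auto)
    also have "(b * rpow ((t - p) / (t + q)) (b - 1) * of_real ((p + q) / (t + q)\<^sup>2)) / (b * of_real (p + q)) =
        rpow (t - p) (b - 1) * (inverse (rpow (t + q) (b - 1)) * inverse (of_real (t + q) * of_real (t + q)))"
    proof -
      have "of_real (p + q) \<noteq> (0::complex)" using pq by (simp only: of_real_eq_0_iff)
      thus ?thesis using b0 unfolding rpow_divide[OF pos(2,1)] power2_eq_square
        by (simp add: divide_inverse mult_ac del: of_real_add)
    qed
    also have "inverse (rpow (t + q) (b - 1)) * inverse (of_real (t + q) * of_real (t + q)) =
        rpow (t + q) (- (b - 1)) * rpow (t + q) (- (1 + 1))"
      using pos by (simp only: rpow_minus rpow_add rpow_one)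
    also have "\<dots> = rpow (t + q) (- (b - 1) + - (1 + 1))" by (rule rpow_add[symmetric])
    also have "- (b - 1) + - (1 + 1) = - b - 1" by simp
    finally show ?thesis .
  qed
  have cont: "isCont ?f t" if "t > p" for t
  proof -
    have "continuous_on {p<..} ?f" using pq by (intro continuous_intros) auto
    thus ?thesis using that by (simp add: continuous_on_eq_continuous_at)
  qed
  have lim0: "(?F \<longlongrightarrow> 0) (at_right p)"
  proof -
    have ev: "eventually (\<lambda>t. (t - p) / (t + q) > 0) (at_right p)"
      using eventually_at_right_less[of p] by eventually_elim (use pq in auto)
    have "((\<lambda>t. ((t - p) / (t + q)) powr Re b) \<longlongrightarrow> 0) (at_right p)"
      by (rule tendsto_zero_powrI[OF stieltjes_ratio_tendsto(1)[OF pq] tendsto_const _ b])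
         (use ev in \<open>auto elim: eventually_mono\<close>)
    hence "((\<lambda>t. rpow ((t - p) / (t + q)) b) \<longlongrightarrow> 0) (at_right p)"
      by (rule Lim_null_comparison[rotated]) (use ev in \<open>auto elim!: eventually_mono simp: norm_rpow\<close>)
    from tendsto_divide[OF this tendsto_const[of "b * of_real (p + q)"]] show ?thesis
      using b0 pq by (simp del: of_real_add)
  qed
  have lim1: "(?F \<longlongrightarrow> 1 / (b * of_real (p + q))) at_top"
  proof -
    have "((\<lambda>t. rpow ((t - p) / (t + q)) b) \<longlongrightarrow> exp (b * of_real (ln 1))) at_top"
      unfolding rpow_def by (intro tendsto_intros stieltjes_ratio_tendsto(2)[OF pq]) auto
    from tendsto_divide[OF this tendsto_const[of "b * of_real (p + q)"]] show ?thesis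
      using b0 pq by (simp del: of_real_add)
  qed
  have "(LBINT t=ereal p..\<infinity>. ?f t) = 1 / (b * of_real (p + q)) - 0"
    by (rule interval_integral_FTC_integrable[of _ _ ?F])
       (use der cont lim0 lim1 int in \<open>auto simp: ereal_tendsto_simps\<close>)
  thus "(LINT t:{p<..}|lborel. ?f t) = 1 / (b * of_real (p + q))"
    by (simp add: interval_lebesgue_integral_def)
qed

subsection \<open>Orthogonality\<close>

lemma abel_kernel_eq_0: "t \<le> 1 \<Longrightarrow> abel_kernel \<mu> t \<theta> = 0"
  using cosh_real_ge_1[of \<theta>] by (auto simp: abel_kernel_def)

lemma abel_kernel_measurable [measurable (raw)]:
  assumes [measurable]: "f \<in> borel_measurable M" "g \<in> borel_measurable M"
  shows "(\<lambda>x. abel_kernel \<mu> (f x) (g x)) \<in> borel_measurable M"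
  unfolding abel_kernel_def by measurable

text \<open>The choice \<open>b = 1/2 - \<mu>\<close> matches both exponents. The integral of the
  norm is also computed exactly, since it decides absolute integrability in both variables.\<close>

lemma abel_kernel_stieltjes:
  assumes mu: "Re \<mu> < 1/2"
  shows "integrable lborel (\<lambda>t. abel_kernel \<mu> t \<theta> * rpow (t + cosh s) (\<mu> - 3/2))"
    and "(LINT t|lborel. abel_kernel \<mu> t \<theta> * rpow (t + cosh s) (\<mu> - 3/2)) =
      indicator {0<..} \<theta> *\<^sub>R (1 / ((1/2 - \<mu>) * of_real (cosh \<theta> + cosh s)))"
    and "(LINT t|lborel. norm (abel_kernel \<mu> t \<theta> * rpow (t + cosh s) (\<mu> - 3/2))) =
      indicator {0<..} \<theta> * (1 / ((1/2 - Re \<mu>) * (cosh \<theta> + cosh s)))"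
proof -
  define b where "b = 1/2 - \<mu>"
  have b: "Re b > 0" using mu by (simp add: b_def)
  have pq: "cosh \<theta> + cosh s > 0" by (intro add_pos_pos) auto
  have e: "- \<mu> - 1/2 = b - 1" "\<mu> - 3/2 = - b - 1" by (simp_all add: b_def)
  have eq: "(\<lambda>t. abel_kernel \<mu> t \<theta> * rpow (t + cosh s) (\<mu> - 3/2)) =
      (\<lambda>t. indicator {0<..} \<theta> *\<^sub>R (indicator {cosh \<theta><..} t *\<^sub>R (rpow (t - cosh \<theta>) (b - 1) * rpow (t + cosh s) (- b - 1))))"
    unfolding abel_kernel_def e by (intro ext) (simp add: indicator_def)
  have eqn: "(\<lambda>t. norm (abel_kernel \<mu> t \<theta> * rpow (t + cosh s) (\<mu> - 3/2))) =
      (\<lambda>t. indicator {0<..} \<theta> * (indicator {cosh \<theta><..} t *\<^sub>R ((t - cosh \<theta>) powr (Re b - 1) * (t + cosh s) powr (- Re b - 1))))"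
  proof
    fix t
    have "t + cosh s > 0" if "t > cosh \<theta>" using that pq by linarith
    thus "norm (abel_kernel \<mu> t \<theta> * rpow (t + cosh s) (\<mu> - 3/2)) =
      indicator {0<..} \<theta> * (indicator {cosh \<theta><..} t *\<^sub>R ((t - cosh \<theta>) powr (Re b - 1) * (t + cosh s) powr (- Re b - 1)))"
      unfolding abel_kernel_def e
      by (cases "0 < \<theta> \<and> cosh \<theta> < t") (auto simp: norm_mult norm_rpow)
  qed
  show "integrable lborel (\<lambda>t. abel_kernel \<mu> t \<theta> * rpow (t + cosh s) (\<mu> - 3/2))"
    unfolding eq using kernel_integral(1)[OF pq b]
    by (intro integrable_scaleR_right) (simp add: set_integrable_def)
  show "(LINT t|lborel. abel_kernel \<mu> t \<theta> * rpow (t + cosh s) (\<mu> - 3/2)) =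
      indicator {0<..} \<theta> *\<^sub>R (1 / ((1/2 - \<mu>) * of_real (cosh \<theta> + cosh s)))"
    unfolding eq integral_scaleR_right set_lebesgue_integral_def[symmetric] kernel_integral(2)[OF pq b]
    by (simp only: b_def)
  show "(LINT t|lborel. norm (abel_kernel \<mu> t \<theta> * rpow (t + cosh s) (\<mu> - 3/2))) =
      indicator {0<..} \<theta> * (1 / ((1/2 - Re \<mu>) * (cosh \<theta> + cosh s)))"
    unfolding eqn integral_mult_right_zero set_lebesgue_integral_def[symmetric] kernel_integral_real(2)[OF pq b]
    by (simp add: b_def)
qed

text \<open>Integrating the norm over \<open>t\<close> first leaves a multiple of
  \<open>1 / (cosh s + cosh \<theta>)\<close> on the half line, which is integrable.\<close>

lemma abel_kernel_stieltjes_joint: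
  assumes mu: "Re \<mu> < 1/2"
  shows "integrable (lborel \<Otimes>\<^sub>M lborel) (\<lambda>(\<theta>, t). abel_kernel \<mu> t \<theta> * rpow (t + cosh s) (\<mu> - 3/2))"
proof (rule lborel_pair.Fubini_integrable)
  have "integrable lborel (\<lambda>\<theta>. indicator {0<..} \<theta> *\<^sub>R (1 / (1/2 - Re \<mu>) * (1 / (cosh s + cosh \<theta>))))"
    by (intro integrable_mult_indicator integrable_mult_right integrable_inverse_cosh_plus_cosh) auto
  also have "(\<lambda>\<theta>. indicator {0<..} \<theta> *\<^sub>R (1 / (1/2 - Re \<mu>) * (1 / (cosh s + cosh \<theta>)))) =
      (\<lambda>\<theta>. LINT t|lborel. norm (abel_kernel \<mu> t \<theta> * rpow (t + cosh s) (\<mu> - 3/2)))"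
    unfolding abel_kernel_stieltjes(3)[OF mu] by (simp add: add.commute)
  finally show "integrable lborel (\<lambda>\<theta>. LINT t|lborel. norm (case (\<theta>, t) of
      (\<theta>, t) \<Rightarrow> abel_kernel \<mu> t \<theta> * rpow (t + cosh s) (\<mu> - 3/2)))" by simp
  show "AE \<theta> in lborel. integrable lborel (\<lambda>t. case (\<theta>, t) of
      (\<theta>, t) \<Rightarrow> abel_kernel \<mu> t \<theta> * rpow (t + cosh s) (\<mu> - 3/2))"
    using abel_kernel_stieltjes(1)[OF mu] by simp
qed measurable

text \<open>For \<open>t > 1\<close> and \<open>m \<noteq> 0\<close> this is the Legendre function
  of index \<open>i m - 1/2\<close> stripped of \<open>(t^2 - 1)^(\<mu>/2)\<close> and of a constant
  free of \<open>m\<close>; the stripped power cancels against the inverse one in the incomplete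
  integral.\<close>

definition abel_cos :: "complex \<Rightarrow> real \<Rightarrow> real \<Rightarrow> complex" where
  "abel_cos \<mu> m t = (LINT \<theta>|lborel. of_real (cos (m * \<theta>)) * abel_kernel \<mu> t \<theta>)"

lemma abel_cos_measurable [measurable]: "abel_cos \<mu> m \<in> borel_measurable borel"
  unfolding abel_cos_def by measurable

lemma abel_cos_eq_0: "t \<le> 1 \<Longrightarrow> abel_cos \<mu> m t = 0"
  by (simp add: abel_cos_def abel_kernel_eq_0)

lemma norm_abel_cos_le:
  assumes mu: "Re \<mu> < 1/2"
  shows "norm (abel_cos \<mu> m t) \<le> (LINT \<theta>|lborel. norm (abel_kernel \<mu> t \<theta>))"
proof (cases "t > 1")
  case True
  show ?thesis unfolding abel_cos_def
    using mehler_int_eq_abel(1)[OF mu True, of m] abel_kernel_integrable[OF mu True]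
    by (intro Bochner_Integration.integral_norm_bound_integral)
       (auto simp: norm_mult intro!: mult_left_le_one_le)
qed (simp add: abel_cos_eq_0)

lemma abel_cos_stieltjes:
  assumes mu: "Re \<mu> < 1/2" and m: "m > 0" and s: "s > 0"
  shows "(LINT t|lborel. rpow (t + cosh s) (\<mu> - 3/2) * abel_cos \<mu> m t) =
    of_real (pi * sin (m * s) / (sinh s * sinh (pi * m))) / (1/2 - \<mu>)"
proof -
  let ?Z = "\<lambda>\<theta> t. abel_kernel \<mu> t \<theta> * rpow (t + cosh s) (\<mu> - 3/2)"
  have joint: "integrable (lborel \<Otimes>\<^sub>M lborel) (case_prod (\<lambda>\<theta> t. of_real (cos (m * \<theta>)) * ?Z \<theta> t))"
    by (rule Bochner_Integration.integrable_bound[OF abel_kernel_stieltjes_joint[OF mu, of s]])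
       (auto simp: norm_mult case_prod_unfold intro!: AE_I2 mult_left_le_one_le)
  have "(LINT t|lborel. rpow (t + cosh s) (\<mu> - 3/2) * abel_cos \<mu> m t) =
      (LINT t|lborel. LINT \<theta>|lborel. of_real (cos (m * \<theta>)) * ?Z \<theta> t)"
    unfolding abel_cos_def by (subst integral_mult_right_zero[symmetric]) (simp only: mult_ac)
  also have "\<dots> = (LINT \<theta>|lborel. LINT t|lborel. of_real (cos (m * \<theta>)) * ?Z \<theta> t)"
    by (rule lborel_pair.Fubini_integral[OF joint])
  also have "\<dots> = (LINT \<theta>|lborel. of_real (indicator {0<..} \<theta> *\<^sub>R (cos (m * \<theta>) / (cosh s + cosh \<theta>))) / (1/2 - \<mu>))"
    unfolding integral_mult_right_zero abel_kernel_stieltjes(2)[OF mu]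
    by (intro Bochner_Integration.integral_cong refl) (simp add: scaleR_conv_of_real add.commute mult_ac)
  also have "\<dots> = of_real (LINT \<theta>:{0<..}|lborel. cos (m * \<theta>) / (cosh s + cosh \<theta>)) / (1/2 - \<mu>)"
    unfolding set_lebesgue_integral_def by (simp only: integral_divide_zero integral_complex_of_real)
  finally show ?thesis unfolding fourier_cosh_kernel[OF m s] .
qed

section \<open>The transformed incomplete integral and a common majorant\<close>

definition inc_sin :: "complex \<Rightarrow> real \<Rightarrow> real \<Rightarrow> complex" where
  "inc_sin \<mu> n t = (LINT s:{0..pi}|lborel. of_real (sin (n * s) * sinh s) * rpow (t + cosh s) (\<mu> - 3/2))"

lemma inc_sin_measurable [measurable]: "inc_sin \<mu> n \<in> borel_measurable borel"
  unfolding inc_sin_def set_lebesgue_integral_def by measurable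

text \<open>The exponent has negative real part, so the modulus is largest at
  \<open>s = 0\<close>.\<close>

lemma norm_rpow_shift_le:
  assumes "Re \<mu> < 1/2" "t > 1"
  shows "norm (rpow (t + cosh s) (\<mu> - 3/2)) \<le> norm (rpow (t + 1) (\<mu> - 3/2))"
proof -
  have "t + 1 > 0" "t + cosh s \<ge> t + 1" using assms cosh_real_ge_1[of s] by auto
  hence "t + cosh s > 0" by linarith
  have "(t + cosh s) powr (Re \<mu> - 3/2) \<le> (t + 1) powr (Re \<mu> - 3/2)"
    using assms \<open>t + cosh s \<ge> t + 1\<close> by (intro powr_mono2') auto
  thus ?thesis using \<open>t + 1 > 0\<close> \<open>t + cosh s > 0\<close> by (simp add: norm_rpow)
qed

lemma inc_sin_integrand_le:
  assumes "Re \<mu> < 1/2" "t > 1" "s \<in> {0..pi}"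
  shows "norm (of_real (sin (n * s) * sinh s) * rpow (t + cosh s) (\<mu> - 3/2)) \<le>
    sinh pi * norm (rpow (t + 1) (\<mu> - 3/2))"
proof -
  have "\<bar>sin (n * s)\<bar> * \<bar>sinh s\<bar> \<le> 1 * sinh pi"
    using assms(3) by (intro mult_mono) auto
  thus ?thesis unfolding norm_mult norm_of_real abs_mult
    using norm_rpow_shift_le[OF assms(1,2), of s] by (intro mult_mono) auto
qed

lemma norm_inc_sin_le:
  assumes mu: "Re \<mu> < 1/2" and t: "t > 1"
  shows "norm (inc_sin \<mu> n t) \<le> pi * sinh pi * norm (rpow (t + 1) (\<mu> - 3/2))"
proof -
  let ?C = "sinh pi * norm (rpow (t + 1) (\<mu> - 3/2))"
  let ?f = "\<lambda>s. indicator {0..pi} s *\<^sub>R (of_real (sin (n * s) * sinh s) * rpow (t + cosh s) (\<mu> - 3/2))"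
  have iC: "integrable lborel (\<lambda>s. indicator {0..pi} s * ?C)" by simp
  have le: "norm (?f s) \<le> indicator {0..pi} s * ?C" for s
    using inc_sin_integrand_le[OF mu t, of s n] by (auto simp: indicator_def)
  have "integrable lborel ?f"
    by (rule Bochner_Integration.integrable_bound[OF iC]) (use le in \<open>auto intro!: AE_I2 order_trans[OF le]\<close>)
  hence "norm (inc_sin \<mu> n t) \<le> (LINT s|lborel. indicator {0..pi} s * ?C)"
    unfolding inc_sin_def set_lebesgue_integral_def using iC le
    by (intro Bochner_Integration.integral_norm_bound_integral)
  also have "\<dots> = pi * ?C" by simp
  finally show ?thesis by (simp add: mult_ac)
qed

definition leg_majorant :: "complex \<Rightarrow> real \<Rightarrow> real" where
  "leg_majorant \<mu> t = (LINT \<theta>|lborel. norm (abel_kernel \<mu> t \<theta>)) * norm (rpow (t + 1) (\<mu> - 3/2))"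

lemma leg_majorant_nonneg: "leg_majorant \<mu> t \<ge> 0"
  by (simp add: leg_majorant_def)

text \<open>Integrating the modulus of the joint kernel at \<open>s = 0\<close>, where
  \<open>cosh s = 1\<close>, over \<open>\<theta>\<close> gives exactly the majorant, so Fubini
  hands over its integrability.\<close>

lemma leg_majorant_integrable:
  assumes mu: "Re \<mu> < 1/2"
  shows "integrable lborel (leg_majorant \<mu>)"
proof -
  have "integrable (lborel \<Otimes>\<^sub>M lborel) (\<lambda>(\<theta>, t). norm (abel_kernel \<mu> t \<theta> * rpow (t + cosh 0) (\<mu> - 3/2)))"
    using integrable_norm[OF abel_kernel_stieltjes_joint[OF mu, of 0]] by (simp add: case_prod_unfold)
  from lborel_pair.integrable_snd[OF this] show ?thesis
    by (simp add: leg_majorant_def[abs_def] norm_mult)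
qed

lemma norm_inc_abel_le:
  assumes mu: "Re \<mu> < 1/2"
  shows "norm (inc_sin \<mu> n t * abel_cos \<mu> m t) \<le> pi * sinh pi * leg_majorant \<mu> t"
proof (cases "t > 1")
  case True
  have "norm (inc_sin \<mu> n t) * norm (abel_cos \<mu> m t) \<le>
     (pi * sinh pi * norm (rpow (t + 1) (\<mu> - 3/2))) * (LINT \<theta>|lborel. norm (abel_kernel \<mu> t \<theta>))"
    by (intro mult_mono norm_inc_sin_le[OF mu True] norm_abel_cos_le[OF mu]) auto
  thus ?thesis by (simp add: norm_mult leg_majorant_def mult_ac)
qed (simp add: abel_cos_eq_0 leg_majorant_nonneg)

lemma inc_abel_integrable:
  assumes mu: "Re \<mu> < 1/2"
  shows "integrable lborel (\<lambda>t. inc_sin \<mu> n t * abel_cos \<mu> m t)"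
proof (rule Bochner_Integration.integrable_bound)
  show "integrable lborel (\<lambda>t. pi * sinh pi * leg_majorant \<mu> t)"
    using leg_majorant_integrable[OF mu] by (rule integrable_mult_right)
  show "AE t in lborel. norm (inc_sin \<mu> n t * abel_cos \<mu> m t) \<le> norm (pi * sinh pi * leg_majorant \<mu> t)"
    by (intro AE_I2 order_trans[OF norm_inc_abel_le[OF mu]]) simp
qed measurable

lemma sin_orthogonal:
  fixes m n :: nat
  assumes "m > 0" "n > 0"
  shows "(LINT s:{0..pi}|lborel. sin (real n * s) * sin (real m * s)) = (if m = n then pi / 2 else 0)"
proof -
  define p where "p = real n - real m"
  define q where "q = real n + real m"
  have q: "q \<noteq> 0" "sin (q * pi) = 0"
    using assms sin_npi[of "n + m"] by (simp_all add: q_def)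
  have "sin (p * pi) = sin (real n * pi) * cos (real m * pi) - cos (real n * pi) * sin (real m * pi)"
    by (simp add: p_def left_diff_distrib sin_diff)
  hence p: "sin (p * pi) = 0" by simp
  \<comment> \<open>For \<open>m = n\<close> the frequency \<open>p\<close> is zero and
    \<open>cos (p * s)\<close> has the primitive \<open>s\<close>; the case distinction avoids the
    quotient by \<open>p\<close>.\<close>
  define F where "F = (\<lambda>s. ((if m = n then s else sin (p * s) / p) - sin (q * s) / q) / 2)"
  have prod: "sin (real n * s) * sin (real m * s) = (cos (p * s) - cos (q * s)) / 2" for s
    by (simp add: p_def q_def left_diff_distrib distrib_right cos_diff cos_add)
  have "(F has_real_derivative (cos (p * s) - cos (q * s)) / 2) (at s within A)" for s A
    unfolding F_def using q by (cases "m = n") (auto intro!: derivative_eq_intros simp: p_def)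
  hence "((\<lambda>s. sin (real n * s) * sin (real m * s)) has_integral (F pi - F 0)) {0..pi}"
    unfolding prod by (intro fundamental_theorem_of_calculus)
       (auto simp: has_real_derivative_iff_has_vector_derivative[symmetric])
  moreover have "F pi - F 0 = (if m = n then pi / 2 else 0)" using p q by (simp add: F_def)
  moreover have "set_integrable lborel {0..pi} (\<lambda>s. sin (real n * s) * sin (real m * s))"
    by (intro borel_integrable_atLeastAtMost' continuous_intros)
  ultimately show ?thesis using set_borel_integral_eq_integral(2) by (metis integral_unique)
qed

text \<open>The exchange of \<open>s\<close> and \<open>t\<close> is dominated by a constant on a
  compact interval in \<open>s\<close> times \<open>leg_majorant\<close> in \<open>t\<close>. The
  value multiplies \<open>pi / sinh (pi * m)\<close> from the cosine transform by
  \<open>pi / 2\<close>, the squared norm of a sine on \<open>[0, pi]\<close>.\<close>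

lemma inc_abel_integral:
  fixes m n :: nat
  assumes mu: "Re \<mu> < 1/2" and mn: "m > 0" "n > 0"
  shows "(LINT t|lborel. inc_sin \<mu> n t * abel_cos \<mu> m t) =
    (if m = n then of_real (pi\<^sup>2 / (2 * sinh (pi * m))) / (1/2 - \<mu>) else 0)"
proof -
  define r where "r = (\<lambda>s::real. \<lambda>t. rpow (t + cosh s) (\<mu> - 3/2) * abel_cos \<mu> m t)"
  define w where "w = (\<lambda>s::real. \<lambda>t. indicator {0..pi} s *\<^sub>R (of_real (sin (n * s) * sinh s) * r s t))"
  have [measurable]: "case_prod w \<in> borel_measurable (lborel \<Otimes>\<^sub>M lborel)"
    unfolding w_def r_def by measurable
  have dom: "norm (w s t) \<le> indicator {0..pi} s * (sinh pi * leg_majorant \<mu> t)" for s t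
  proof (cases "s \<in> {0..pi} \<and> t > 1")
    case True
    hence "norm (of_real (sin (n * s) * sinh s) * rpow (t + cosh s) (\<mu> - 3/2)) * norm (abel_cos \<mu> m t) \<le>
       (sinh pi * norm (rpow (t + 1) (\<mu> - 3/2))) * (LINT \<theta>|lborel. norm (abel_kernel \<mu> t \<theta>))"
      by (intro mult_mono inc_sin_integrand_le[OF mu] norm_abel_cos_le[OF mu]) auto
    thus ?thesis using True by (simp add: w_def r_def norm_mult leg_majorant_def mult_ac)
  qed (auto simp: w_def r_def indicator_def abel_cos_eq_0 leg_majorant_nonneg)
  have [measurable]: "leg_majorant \<mu> \<in> borel_measurable borel"
    using leg_majorant_integrable[OF mu] by simp
  have "integrable (lborel \<Otimes>\<^sub>M lborel) (\<lambda>(s, t). indicator {0..pi} s * (sinh pi * leg_majorant \<mu> t))"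
  proof (rule lborel_pair.Fubini_integrable)
    have "integrable lborel (\<lambda>s. indicator {0..pi} s * (sinh pi * (LINT t|lborel. leg_majorant \<mu> t)))"
      by simp
    also have "(\<lambda>s. indicator {0..pi} s * (sinh pi * (LINT t|lborel. leg_majorant \<mu> t))) =
        (\<lambda>s. LINT t|lborel. norm (indicator {0..pi} s * (sinh pi * leg_majorant \<mu> t)))"
      by (simp add: abs_mult leg_majorant_nonneg)
    finally show "integrable lborel (\<lambda>s. LINT t|lborel.
        norm (case (s, t) of (s, t) \<Rightarrow> indicator {0..pi} s * (sinh pi * leg_majorant \<mu> t)))" by simp
    show "AE s in lborel. integrable lborel (\<lambda>t. case (s, t) of (s, t) \<Rightarrow> indicator {0..pi} s * (sinh pi * leg_majorant \<mu> t))"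
      using leg_majorant_integrable[OF mu] by simp
  qed measurable
  hence joint: "integrable (lborel \<Otimes>\<^sub>M lborel) (case_prod w)"
    by (rule Bochner_Integration.integrable_bound)
       (auto intro!: AE_I2 order_trans[OF dom] simp: case_prod_unfold)
  have "(LINT t|lborel. inc_sin \<mu> n t * abel_cos \<mu> m t) = (LINT t|lborel. LINT s|lborel. w s t)"
    unfolding inc_sin_def set_lebesgue_integral_def
    by (subst integral_mult_left_zero[symmetric])
       (simp add: w_def r_def mult.assoc scaleR_conv_of_real)
  also have "\<dots> = (LINT s|lborel. LINT t|lborel. w s t)"
    by (rule lborel_pair.Fubini_integral[OF joint])
  also have "\<dots> = (LINT s|lborel. of_real (indicator {0..pi} s *\<^sub>R (sin (n * s) * sin (m * s))) *
      (of_real (pi / sinh (pi * m)) / (1/2 - \<mu>)))"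
  proof (rule Bochner_Integration.integral_cong[OF refl])
    fix s :: real
    have "(LINT t|lborel. w s t) = indicator {0..pi} s *\<^sub>R (of_real (sin (n * s) * sinh s) * (LINT t|lborel. r s t))"
      unfolding w_def by simp
    also have "\<dots> = of_real (indicator {0..pi} s *\<^sub>R (sin (n * s) * sin (m * s))) *
      (of_real (pi / sinh (pi * m)) / (1/2 - \<mu>))"
    \<comment> \<open>The cosine transform needs \<open>s > 0\<close>; at \<open>s = 0\<close> both
      sides vanish with the sine, and for negative \<open>s\<close> with the indicator.\<close>
    proof (cases "s > 0")
      case True
      thus ?thesis using abel_cos_stieltjes[OF mu _ True, of m] mn
        by (simp add: r_def scaleR_conv_of_real)
    next
      case False
      thus ?thesis by (cases "s = 0") auto
    qed
    finally show "(LINT t|lborel. w s t) = of_real (indicator {0..pi} s *\<^sub>R (sin (n * s) * sin (m * s))) *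
      (of_real (pi / sinh (pi * m)) / (1/2 - \<mu>))" .
  qed
  also have "\<dots> = of_real (LINT s:{0..pi}|lborel. sin (n * s) * sin (m * s)) * (of_real (pi / sinh (pi * m)) / (1/2 - \<mu>))"
    unfolding set_lebesgue_integral_def by (simp only: integral_mult_left_zero integral_complex_of_real)
  also have "\<dots> = (if m = n then of_real (pi\<^sup>2 / (2 * sinh (pi * m))) / (1/2 - \<mu>) else 0)"
    unfolding sin_orthogonal[OF mn] by (simp add: power2_eq_square)
  finally show ?thesis .
qed

text \<open>Differentiating \<open>sin (n s) / n\<close> times the power of
  \<open>cosh s + t\<close> gives the defining integrand plus a multiple of the
  \<open>inc_sin\<close> integrand. This primitive vanishes at 0 and, \<open>n\<close> being an
  integer, at pi, so the two integrals are proportional with ratio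
  \<open>(1/2 - \<mu>) / n\<close>.\<close>

lemma LegP_inc_eq:
  assumes mu: "Re \<mu> < 1/2" and n: "n > (0::nat)" and t: "t > 1"
  shows "LegP_inc \<mu> (\<i> * of_nat n - 1/2) t pi =
    of_real (sqrt (2 / pi)) * Gamma (1/2 - \<mu>) * rpow (t\<^sup>2 - 1) (- \<mu> / 2) /
      (Gamma (1/2 + \<i> * of_nat n - \<mu>) * Gamma (1/2 - \<i> * of_nat n - \<mu>)) *
      ((1/2 - \<mu>) / of_nat n * inc_sin \<mu> n t)"
proof -
  have pos: "cosh s + t > 0" for s :: real using t by (intro add_pos_pos) auto
  define G where "G = (\<lambda>s::real. of_real (sin (n * s) * sinh s) * rpow (t + cosh s) (\<mu> - 3/2))"
  have contG: "continuous_on {0..pi} G"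
    unfolding G_def using pos by (intro continuous_intros) (auto simp: add.commute)
  have G_int: "inc_sin \<mu> n t = integral {0..pi} G"
    unfolding inc_sin_def G_def[symmetric]
    by (rule set_borel_integral_eq_integral(2)[OF borel_integrable_atLeastAtMost'[OF contG]])
  have "((\<lambda>s. of_real (cos (n * s)) * rpow (cosh s + t) (\<mu> - 1/2) + (\<mu> - 1/2) / of_nat n * G s)
      has_integral (of_real (sin (n * pi) / n) * rpow (cosh pi + t) (\<mu> - 1/2) -
         of_real (sin (real n * 0) / n) * rpow (cosh 0 + t) (\<mu> - 1/2))) {0..pi}"
  proof (rule fundamental_theorem_of_calculus)
    fix s :: real assume "s \<in> {0..pi}"
    have d1: "((\<lambda>s. complex_of_real (sin (n * s) / n)) has_vector_derivative of_real (cos (n * s))) (at s)"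
      using n by (intro has_vector_derivative_of_real)
        (auto intro!: derivative_eq_intros simp: has_real_derivative_iff_has_vector_derivative[symmetric])
    have d2: "((\<lambda>s. rpow (cosh s + t) (\<mu> - 1/2)) has_vector_derivative
        (\<mu> - 1/2) * rpow (cosh s + t) (\<mu> - 1/2 - 1) * of_real (sinh s)) (at s)"
      by (rule has_vector_derivative_rpow[OF pos]) (auto intro!: derivative_eq_intros)
    have e: "\<mu> - 1/2 - 1 = \<mu> - 3/2" by simp
    have "((\<lambda>s. of_real (sin (n * s) / n) * rpow (cosh s + t) (\<mu> - 1/2)) has_vector_derivative
        of_real (sin (n * s) / n) * ((\<mu> - 1/2) * rpow (cosh s + t) (\<mu> - 1/2 - 1) * of_real (sinh s))
        + of_real (cos (n * s)) * rpow (cosh s + t) (\<mu> - 1/2)) (at s)"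
      by (rule has_vector_derivative_mult[OF d1 d2])
    also have "of_real (sin (n * s) / n) * ((\<mu> - 1/2) * rpow (cosh s + t) (\<mu> - 1/2 - 1) * of_real (sinh s))
        + of_real (cos (n * s)) * rpow (cosh s + t) (\<mu> - 1/2) =
        of_real (cos (n * s)) * rpow (cosh s + t) (\<mu> - 1/2) + (\<mu> - 1/2) / of_nat n * G s"
      unfolding e G_def by (simp add: add.commute[of t] mult_ac)
    finally show "((\<lambda>s. of_real (sin (n * s) / n) * rpow (cosh s + t) (\<mu> - 1/2)) has_vector_derivative
        of_real (cos (n * s)) * rpow (cosh s + t) (\<mu> - 1/2) + (\<mu> - 1/2) / of_nat n * G s) (at s within {0..pi})"
      by (rule has_vector_derivative_at_within)
  qed simp
  hence h1: "((\<lambda>s. of_real (cos (n * s)) * rpow (cosh s + t) (\<mu> - 1/2) + (\<mu> - 1/2) / of_nat n * G s) has_integral 0) {0..pi}"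
    by simp
  have h2: "((\<lambda>s. (\<mu> - 1/2) / of_nat n * G s) has_integral (\<mu> - 1/2) / of_nat n * integral {0..pi} G) {0..pi}"
    by (intro has_integral_mult_right integrable_integral integrable_continuous_interval contG)
  have "((\<lambda>s. of_real (cos (n * s)) * rpow (cosh s + t) (\<mu> - 1/2)) has_integral
      (0 - (\<mu> - 1/2) / of_nat n * integral {0..pi} G)) {0..pi}"
    using has_integral_diff[OF h1 h2] by (simp only: add_diff_cancel_right')
  hence C: "integral {0..pi} (\<lambda>s. of_real (cos (n * s)) * rpow (cosh s + t) (\<mu> - 1/2)) =
      (1/2 - \<mu>) / of_nat n * inc_sin \<mu> n t"
    unfolding G_int by (simp add: integral_unique diff_divide_distrib left_diff_distrib)
  have integrand: "cosh (of_real s * (\<i> * of_nat n - 1/2 + 1/2)) / of_real (cosh s + t) powr (1/2 - \<mu>) =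
      of_real (cos (n * s)) * rpow (cosh s + t) (\<mu> - 1/2)" for s :: real
  proof -
    have "cosh (of_real s * (\<i> * of_nat n - 1/2 + 1/2)) = of_real (cos (n * s))"
      by (simp add: cosh_conv_cos mult_ac flip: cos_of_real)
    moreover have "of_real (cosh s + t) powr (1/2 - \<mu>) = inverse (rpow (cosh s + t) (\<mu> - 1/2))"
      unfolding rpow_eq_powr[OF pos, symmetric] rpow_minus[symmetric] by simp
    ultimately show ?thesis by (simp only: divide_inverse inverse_inverse_eq)
  qed
  have "t\<^sup>2 - 1 > 0" using t by (simp add: one_less_power)
  hence "of_real (t\<^sup>2 - 1) powr (- \<mu> / 2) = rpow (t\<^sup>2 - 1) (- \<mu> / 2)" by (simp only: rpow_eq_powr)
  moreover have "1 + (\<i> * of_nat n - 1/2) - \<mu> = 1/2 + \<i> * of_nat n - \<mu>" "- (\<i> * of_nat n - 1/2) - \<mu> = 1/2 - \<i> * of_nat n - \<mu>"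
    by simp_all
  ultimately show ?thesis unfolding LegP_inc_def integrand C by (simp only:)
qed

section \<open>Termwise integration and recovery of the coefficients\<close>

theorem theorem3:
  fixes \<mu> :: complex and a :: "nat \<Rightarrow> complex" and f :: "real \<Rightarrow> complex"
  assumes hmu: "\<bar>Re \<mu>\<bar> < 1/2"
    and ha: "summable (\<lambda>m. norm (a (Suc m)))"
    and hf: "\<forall>x>1. f x = (\<Sum>m. a (Suc m) * LegP \<mu> (\<i> * of_nat (Suc m) - 1/2) x)"
  shows "\<forall>x>1.
     (\<forall>n. (\<lambda>t. LegP_inc \<mu> (\<i> * of_nat (Suc n) - 1/2) t pi * f t)
             absolutely_integrable_on {1<..}) \<and>
     summable (\<lambda>n. norm (of_nat (Suc n) * complex_of_real (sinh (pi * real (Suc n)))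
          * Gamma (1/2 + \<i> * of_nat (Suc n) - \<mu>) * Gamma (1/2 - \<i> * of_nat (Suc n) - \<mu>)
          * LegP \<mu> (\<i> * of_nat (Suc n) - 1/2) x
          * integral {1<..} (\<lambda>t. LegP_inc \<mu> (\<i> * of_nat (Suc n) - 1/2) t pi * f t))) \<and>
     f x = 1 / complex_of_real pi *
       (\<Sum>n. of_nat (Suc n) * complex_of_real (sinh (pi * real (Suc n)))
          * Gamma (1/2 + \<i> * of_nat (Suc n) - \<mu>) * Gamma (1/2 - \<i> * of_nat (Suc n) - \<mu>)
          * LegP \<mu> (\<i> * of_nat (Suc n) - 1/2) x
          * integral {1<..} (\<lambda>t. LegP_inc \<mu> (\<i> * of_nat (Suc n) - 1/2) t pi * f t))"
proof -
  have mu: "Re \<mu> < 1/2" using hmu by linarith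
  define c where "c = of_real (sqrt (2 / pi)) / Gamma (1/2 - \<mu>)"
  define R where "R = (\<lambda>m. abel_cos \<mu> (real (Suc m)))"
  define P where "P = (\<lambda>m. LegP \<mu> (\<i> * of_nat (Suc m) - 1/2))"
  define W where "W = (\<lambda>n t. LegP_inc \<mu> (\<i> * of_nat (Suc n) - 1/2) t pi)"
  define GG where "GG = (\<lambda>n. Gamma (1/2 + \<i> * of_nat (Suc n) - \<mu>) * Gamma (1/2 - \<i> * of_nat (Suc n) - \<mu>))"
  \<comment> \<open>What survives of the two prefactors: the powers of \<open>t^2 - 1\<close> and
    the factors \<open>Gamma (1/2 - \<mu>)\<close> cancel between \<open>W\<close> and
    \<open>P\<close>, the roots \<open>sqrt (2 / pi)\<close> multiply, and the integration by parts
    contributes \<open>(1/2 - \<mu>)\<close> over the index.\<close>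
  define K where "K = (\<lambda>n. of_real (2 / pi) * (1/2 - \<mu>) / (of_nat (Suc n) * GG n))"
  have Gamma_nz: "Gamma z \<noteq> 0" if "Re z > 0" for z :: complex
    using that by (subst Gamma_eq_zero_iff) (auto elim!: nonpos_Ints_cases)
  have GG0: "GG n \<noteq> 0" for n using mu by (simp add: GG_def Gamma_nz)
  have G0: "Gamma (1/2 - \<mu>) \<noteq> 0" using mu by (simp add: Gamma_nz)
  have b0: "1/2 - \<mu> \<noteq> 0" using mu by (auto simp: complex_eq_iff)
  have P_eq: "P m t = c * rpow (t\<^sup>2 - 1) (\<mu> / 2) * R m t" if "t > 1" for m t
    using LegP_mehler_dirichlet[OF _ mu that, of "real (Suc m)"]
    by (simp add: P_def c_def R_def abel_cos_def del: of_nat_Suc)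
  have norm_R: "norm (R m t) \<le> (LINT \<theta>|lborel. norm (abel_kernel \<mu> t \<theta>))" for m t
    unfolding R_def by (rule norm_abel_cos_le[OF mu])
  have sum_R: "summable (\<lambda>m. norm (a (Suc m) * R m t))" for t
  proof (rule summable_comparison_test'[of "\<lambda>m. norm (a (Suc m)) * (LINT \<theta>|lborel. norm (abel_kernel \<mu> t \<theta>))" 0])
    show "summable (\<lambda>m. norm (a (Suc m)) * (LINT \<theta>|lborel. norm (abel_kernel \<mu> t \<theta>)))"
      by (rule summable_mult2[OF ha])
    show "norm (norm (a (Suc m) * R m t)) \<le> norm (a (Suc m)) * (LINT \<theta>|lborel. norm (abel_kernel \<mu> t \<theta>))" for m
      using norm_R[of m t] by (simp add: norm_mult mult_left_mono)
  qed
  have sum_P: "summable (\<lambda>m. norm (a (Suc m) * P m t))" if "t > 1" for t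
  proof -
    have "(\<lambda>m. norm (a (Suc m) * P m t)) = (\<lambda>m. norm (c * rpow (t\<^sup>2 - 1) (\<mu> / 2)) * norm (a (Suc m) * R m t))"
      unfolding P_eq[OF that] by (simp add: norm_mult mult_ac)
    thus ?thesis using summable_mult[OF sum_R] by (simp only:)
  qed
  have product: "W n t * P m t = K n * (inc_sin \<mu> (Suc n) t * R m t)" if t: "t > 1" for n m t
  proof -
    have "sqrt (2 / pi) * sqrt (2 / pi) = 2 / pi" by simp
    hence s: "complex_of_real (sqrt (2 / pi)) * of_real (sqrt (2 / pi)) = of_real (2 / pi)"
      by (simp only: of_real_mult[symmetric])
    have r: "rpow (t\<^sup>2 - 1) (- \<mu> / 2) * rpow (t\<^sup>2 - 1) (\<mu> / 2) = 1"
      by (simp add: rpow_def flip: exp_add)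
    have "W n t * P m t = (complex_of_real (sqrt (2 / pi)) * of_real (sqrt (2 / pi))) *
        (rpow (t\<^sup>2 - 1) (- \<mu> / 2) * rpow (t\<^sup>2 - 1) (\<mu> / 2)) * (Gamma (1/2 - \<mu>) / Gamma (1/2 - \<mu>)) *
        ((1/2 - \<mu>) / (of_nat (Suc n) * GG n)) * (inc_sin \<mu> (Suc n) t * R m t)"
      unfolding P_eq[OF t] W_def LegP_inc_eq[OF mu zero_less_Suc t] GG_def c_def
      by (simp add: mult_ac del: of_nat_Suc)
    thus ?thesis unfolding s r using G0 by (simp add: K_def)
  qed
  define g where "g = (\<lambda>n m t. a (Suc m) * (K n * (inc_sin \<mu> (Suc n) t * R m t)))"
  \<comment> \<open>\<open>abel_cos\<close> vanishes for \<open>t \<le> 1\<close>, so integrals of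
    \<open>g\<close> over the line are the required ones over \<open>{1<..}\<close>; the unspecified
    values of \<open>f\<close> elsewhere are masked by the indicator.\<close>
  have g_sums: "(\<Sum>m. g n m t) = indicator {1<..} t *\<^sub>R (W n t * f t)" for n t
  proof (cases "t > 1")
    case True
    have "W n t * f t = W n t * (\<Sum>m. a (Suc m) * P m t)"
      using hf True by (simp add: P_def)
    also have "\<dots> = (\<Sum>m. W n t * (a (Suc m) * P m t))"
      by (rule suminf_mult[symmetric, OF summable_norm_cancel[OF sum_P[OF True]]])
    also have "\<dots> = (\<Sum>m. g n m t)"
      using product[OF True] by (intro suminf_cong) (simp add: g_def mult.left_commute)
    finally show ?thesis using True by simp
  qed (simp add: g_def R_def abel_cos_eq_0)
  have g_int: "integrable lborel (g n m)" for n m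
    unfolding g_def R_def by (intro integrable_mult_right inc_abel_integrable[OF mu])
  \<comment> \<open>One constant for all \<open>m\<close>, so that summability of the coefficients
    alone makes the series of integrated norms converge.\<close>
  define C where "C = (\<lambda>n. norm (K n) * (pi * sinh pi * (LINT t|lborel. leg_majorant \<mu> t)))"
  have g_norm_int: "(LINT t|lborel. norm (g n m t)) \<le> norm (a (Suc m)) * C n" for n m
  proof -
    have "norm (g n m t) \<le> norm (a (Suc m)) * (norm (K n) * (pi * sinh pi * leg_majorant \<mu> t))" for t
      unfolding g_def R_def norm_mult[of "a (Suc m)"] norm_mult[of "K n"]
      by (intro mult_left_mono norm_inc_abel_le[OF mu]) auto
    hence "(LINT t|lborel. norm (g n m t)) \<le>
       (LINT t|lborel. norm (a (Suc m)) * (norm (K n) * (pi * sinh pi * leg_majorant \<mu> t)))"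
      by (intro integral_mono integrable_norm g_int integrable_mult_right leg_majorant_integrable[OF mu])
    also have "\<dots> = norm (a (Suc m)) * C n" by (simp add: C_def)
    finally show ?thesis .
  qed
  have g_abs: "summable (\<lambda>m. norm (g n m t))" for n t
  proof -
    have "(\<lambda>m. norm (g n m t)) = (\<lambda>m. norm (K n * inc_sin \<mu> (Suc n) t) * norm (a (Suc m) * R m t))"
      by (simp add: g_def norm_mult mult_ac del: of_nat_Suc)
    thus ?thesis using summable_mult[OF sum_R] by (simp only:)
  qed
  have g_abs_int: "summable (\<lambda>m. LINT t|lborel. norm (g n m t))" for n
    by (rule summable_comparison_test'[OF summable_mult2[OF ha, of "C n"], of 0])
       (use g_norm_int in simp)
  have int1: "integrable lborel (\<lambda>t. \<Sum>m. g n m t)" for n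
    by (rule integrable_suminf[OF g_int AE_I2[OF g_abs] g_abs_int])
  have int2: "(LINT t|lborel. (\<Sum>m. g n m t)) = a (Suc n) * of_real pi /
      (of_nat (Suc n) * of_real (sinh (pi * real (Suc n))) * GG n)" for n
  proof -
    define v where "v = K n * (of_real (pi\<^sup>2 / (2 * sinh (pi * real (Suc n)))) / (1/2 - \<mu>))"
    have alg: "x * b / y * (z / b) = x * z / y" if "b \<noteq> 0" for x b y z :: complex
      using that by simp
    have "integral\<^sup>L lborel (g n m) = (if m = n then a (Suc n) * v else 0)" for m
      unfolding g_def R_def v_def
      by (simp only: integral_mult_right_zero inc_abel_integral[OF mu zero_less_Suc zero_less_Suc]) simp
    hence "(LINT t|lborel. (\<Sum>m. g n m t)) = (\<Sum>m. if m = n then a (Suc n) * v else 0)"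
      using integral_suminf[OF g_int AE_I2[OF g_abs] g_abs_int, of n] by simp
    also have "\<dots> = a (Suc n) * v"
      by (subst suminf_finite[of "{n}"]) auto
    \<comment> \<open>The factor \<open>1/2 - \<mu>\<close> from the integration by parts cancels
      the one produced by the Stieltjes integral.\<close>
    also have "v = of_real (2 / pi * (pi\<^sup>2 / (2 * sinh (pi * real (Suc n))))) / (of_nat (Suc n) * GG n)"
      unfolding v_def K_def of_real_mult by (rule alg[OF b0])
    also have "2 / pi * (pi\<^sup>2 / (2 * sinh (pi * real (Suc n)))) = pi / sinh (pi * real (Suc n))"
      by (simp add: power2_eq_square)
    finally show ?thesis by (simp add: mult_ac del: of_nat_Suc)
  qed
  have si: "set_integrable lborel {1<..} (\<lambda>t. W n t * f t)" for n
    using int1[of n] unfolding g_sums set_integrable_def .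
  have ai: "(\<lambda>t. W n t * f t) absolutely_integrable_on {1<..}" for n
    using si[of n] borel_set_integrable_iff[of "{1<..}" "\<lambda>t. W n t * f t"]
    by (simp add: set_borel_measurable_def set_integrable_def borel_measurable_integrable)
  have val: "integral {1<..} (\<lambda>t. W n t * f t) = a (Suc n) * of_real pi /
      (of_nat (Suc n) * of_real (sinh (pi * real (Suc n))) * GG n)" for n
    using set_borel_integral_eq_integral(2)[OF si[of n]] int2[of n]
    unfolding g_sums set_lebesgue_integral_def by (simp only:)
  \<comment> \<open>The computed integral cancels every factor in front of the Legendre function, so
    the asserted series is \<open>pi\<close> times the defining series of \<open>f\<close>; absolute
    convergence and value are inherited from it.\<close>
  have coeff: "of_nat (Suc n) * complex_of_real (sinh (pi * real (Suc n)))
          * Gamma (1/2 + \<i> * of_nat (Suc n) - \<mu>) * Gamma (1/2 - \<i> * of_nat (Suc n) - \<mu>)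
          * P n x * integral {1<..} (\<lambda>t. W n t * f t) = of_real pi * (a (Suc n) * P n x)" for n x
  proof -
    define D where "D = of_nat (Suc n) * complex_of_real (sinh (pi * real (Suc n))) * GG n"
    have "of_nat (Suc n) \<noteq> (0::complex)" by (simp only: of_nat_eq_0_iff)
    hence D0: "D \<noteq> 0" using GG0[of n] by (simp add: D_def del: of_nat_Suc)
    have "of_nat (Suc n) * complex_of_real (sinh (pi * real (Suc n)))
          * Gamma (1/2 + \<i> * of_nat (Suc n) - \<mu>) * Gamma (1/2 - \<i> * of_nat (Suc n) - \<mu>)
          * P n x * integral {1<..} (\<lambda>t. W n t * f t) = D * P n x * (a (Suc n) * of_real pi / D)"
      unfolding val D_def by (simp only: GG_def mult.assoc)
    also have "\<dots> = of_real pi * (a (Suc n) * P n x)" using D0 by simp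
    finally show ?thesis .
  qed
  have P_fold: "LegP \<mu> (\<i> * of_nat (Suc n) - 1/2) = P n" for n by (simp only: P_def)
  have W_fold: "LegP_inc \<mu> (\<i> * of_nat (Suc n) - 1/2) t pi = W n t" for n t by (simp only: W_def)
  show ?thesis
    unfolding P_fold W_fold coeff
  proof (intro allI impI conjI)
    fix x :: real assume x: "x > 1"
    show "(\<lambda>t. W n t * f t) absolutely_integrable_on {1<..}" for n by (rule ai)
    show "summable (\<lambda>n. norm (of_real pi * (a (Suc n) * P n x)))"
      unfolding norm_mult[of "of_real pi"] by (rule summable_mult[OF sum_P[OF x]])
    have "(\<Sum>n. of_real pi * (a (Suc n) * P n x)) = of_real pi * (\<Sum>n. a (Suc n) * P n x)"
      by (rule suminf_mult[OF summable_norm_cancel[OF sum_P[OF x]]])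
    thus "f x = 1 / of_real pi * (\<Sum>n. of_real pi * (a (Suc n) * P n x))"
      using hf x by (simp add: P_def)
  qed
qed

end
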